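(* Every tree with at least one edge, and every unicyclic graph, is extra-good.
   Context: All graphs are finite and simple; $V(G)$, $E(G)$ are the vertex and edge sets, $\mathrm{v}(G)=|V(G)|$, $\mathrm{e}(G)=|E(G)|$. A connected graph $G$ is unicyclic if $\mathrm{e}(G)=\mathrm{v}(G)$. $\mu$ is Lebesgue measure on $[0,1]$. $\mathcal{H}$ is the space of bounded measurable real functions on $[0,1]^2$. A bounded measurable nonnegative symmetric function $g$ on $[0,1]^2$ is called doubly nonnegative if there is $h\in\mathcal{H}$ (possibly taking negative values) with $g(x,y)=\int_{[0,1]}h(x,z)h(y,z)\,d\mu(z)$ for (almost) all $x,y$. A graph $G$ with vertices $v_1,\dots,v_n$, $n=\mathrm{v}(G)$, and at least one edge is called extra-good if for every doubly nonnegative function $g$ and all bounded measurable nonnegative functions $f_1,\dots,f_n$ on $[0,1]$, $$\int_{[0,1]^n}\prod_{\{v_i,v_j\}\in E(G)}g(x_i,x_j)\prod_{i=1}^n f_i(x_i)\,d\mu^n\;\ge\;\Big(\int_{[0,1]^2}f(x)g(x,y)f(y)\,d\mu^2\Big)^{\mathrm{e}(G)},$$ where $f(x)=\big(\prod_{i=1}^n f_i(x)\big)^{1/(2\mathrm{e}(G))}$. *)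

theory Defs
  imports "HOL-Analysis.Analysis"
begin

section \<open>Finite simple graphs\<close>

text \<open>
  A graph is given by its vertex set \<open>V\<close> and its set \<open>E\<close> of edges, the edges being two-element
  subsets of \<open>V\<close>. (Symmetric digraphs in the sense of \<open>Graph_Theory\<close> are not suitable here:
  traversing an edge back and forth counts as a cycle there.)
\<close>

definition simple_graph :: "'a set \<Rightarrow> 'a set set \<Rightarrow> bool" where
  "simple_graph V E \<longleftrightarrow> finite V \<and> (\<forall>e\<in>E. e \<subseteq> V \<and> card e = 2)"

definition connected_graph :: "'a set \<Rightarrow> 'a set set \<Rightarrow> bool" where
  "connected_graph V E \<longleftrightarrow> simple_graph V E \<and> V \<noteq> {} \<and>
     (\<forall>u\<in>V. \<forall>v\<in>V. (u, v) \<in> {(a, b). {a, b} \<in> E}\<^sup>*)"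

definition cycle_in :: "'a set set \<Rightarrow> 'a list \<Rightarrow> bool" where
  "cycle_in E c \<longleftrightarrow> length c \<ge> 3 \<and> distinct c \<and>
     (\<forall>i<length c. {c ! i, c ! (Suc i mod length c)} \<in> E)"

definition tree :: "'a set \<Rightarrow> 'a set set \<Rightarrow> bool" where
  "tree V E \<longleftrightarrow> connected_graph V E \<and> (\<nexists>c. cycle_in E c)"

definition unicyclic :: "'a set \<Rightarrow> 'a set set \<Rightarrow> bool" where
  "unicyclic V E \<longleftrightarrow> connected_graph V E \<and> card E = card V"


section \<open>Doubly nonnegative functions and extra-good graphs\<close>

abbreviation unit_interval_measure :: "real measure" where
  "unit_interval_measure \<equiv> lebesgue_on {0..1}"

abbreviation unit_square_measure :: "(real \<times> real) measure" where
  "unit_square_measure \<equiv> lebesgue_on ({0..1} \<times> {0..1})"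

text \<open>
  Lebesgue measure on the cube with coordinates indexed by the finite set \<open>V\<close>. The completion
  matters: a Lebesgue measurable function on the square, composed with a pair of coordinates,
  need not be measurable for the product sigma-algebra itself.
\<close>

abbreviation unit_cube_measure :: "'a set \<Rightarrow> ('a \<Rightarrow> real) measure" where
  "unit_cube_measure V \<equiv> completion (\<Pi>\<^sub>M v\<in>V. unit_interval_measure)"

definition bounded_measurable :: "'b measure \<Rightarrow> ('b \<Rightarrow> real) \<Rightarrow> bool" where
  "bounded_measurable M f \<longleftrightarrow> f \<in> borel_measurable M \<and> bounded (f ` space M)"

definition doubly_nonnegative :: "(real \<times> real \<Rightarrow> real) \<Rightarrow> bool" where
  "doubly_nonnegative g \<longleftrightarrow>
     bounded_measurable unit_square_measure g \<and>
     (\<forall>x\<in>{0..1}. \<forall>y\<in>{0..1}. 0 \<le> g (x, y) \<and> g (x, y) = g (y, x)) \<and>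
     (\<exists>h. bounded_measurable unit_square_measure h \<and>
          (AE (x, y) in unit_square_measure.
             g (x, y) = (\<integral>z. h (x, z) * h (y, z) \<partial>unit_interval_measure)))"

text \<open>
  The value \<open>g (x u, x v)\<close> at an edge \<open>{u, v}\<close>. For symmetric \<open>g\<close> it does not depend on the order
  of the endpoints, so the description denotes it uniquely.
\<close>

definition edge_value :: "(real \<times> real \<Rightarrow> real) \<Rightarrow> ('a \<Rightarrow> real) \<Rightarrow> 'a set \<Rightarrow> real" where
  "edge_value g x e = (THE c. \<forall>u v. e = {u, v} \<longrightarrow> c = g (x u, x v))"

text \<open>The functions \<open>f\<^sub>1, \<dots>, f\<^sub>n\<close> are indexed directly by the vertices.\<close>

definition vertex_mean :: "'a set \<Rightarrow> 'a set set \<Rightarrow> ('a \<Rightarrow> real \<Rightarrow> real) \<Rightarrow> real \<Rightarrow> real" where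
  "vertex_mean V E f t = (\<Prod>v\<in>V. f v t) powr (1 / (2 * real (card E)))"

definition extra_good :: "'a set \<Rightarrow> 'a set set \<Rightarrow> bool" where
  "extra_good V E \<longleftrightarrow> simple_graph V E \<and> E \<noteq> {} \<and>
     (\<forall>g f. doubly_nonnegative g \<longrightarrow>
        (\<forall>v\<in>V. bounded_measurable unit_interval_measure (f v) \<and> (\<forall>t\<in>{0..1}. 0 \<le> f v t)) \<longrightarrow>
        (\<integral>x. (\<Prod>e\<in>E. edge_value g x e) * (\<Prod>v\<in>V. f v (x v)) \<partial>unit_cube_measure V)
          \<ge> (\<integral>(s, t). vertex_mean V E f s * g (s, t) * vertex_mean V E f t
                 \<partial>unit_square_measure) ^ card E)"

end

theory Submission
  imports Defs "HOL-Probability.Infinite_Product_Measure"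
begin

text \<open>
  Write \<open>e\<close> for the number of edges of a graph \<open>G\<close> and call the left-hand side of the inequality the
  density of \<open>G\<close> in the kernel \<open>g\<close> with vertex weights \<open>f\<^sub>v\<close>. The idea is to build the graph from a single
  edge or from a cycle by adding leaves.
  
  Adding a leaf \<open>w\<close> at a vertex \<open>v\<close> (\<open>dominates_add_leaf\<close>). Integrating out the coordinate of \<open>w\<close> multiplies
  the weight of \<open>v\<close> by \<open>Q(s) = \<integral> g(s,t) f\<^sub>w(t) dt\<close>, and the inequality for \<open>G\<close> with this new weight bounds the
  density from below by the \<open>e\<close>-th power of \<open>\<integral>\<integral> \<phi>(s) g(s,t) \<phi>(t)\<close>, where \<open>\<phi>\<close> is the mean of the new weights.
  If \<open>\<psi>\<close> denotes the mean for the larger graph, then \<open>\<psi>(s) \<psi>(t)\<close> is a product of powers of \<open>\<phi>(s) \<phi>(t)\<close> and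
  of \<open>f\<^sub>w(s) f\<^sub>w(t) / (Q(s) Q(t))\<close>, and Hoelder's inequality with exponents \<open>(e+1)/e\<close> and \<open>e+1\<close> separates the
  two factors. The second one is harmless, because \<open>\<integral>\<integral> g(s,t) f\<^sub>w(t) / Q(s)\<close> is at most one. A single
  edge is an instance of the inequality between the geometric and the arithmetic mean
  (\<open>dominates_edge\<close>), so every tree with an edge is covered, for any symmetric nonnegative kernel.
  
  Cycles of length \<open>n\<close> (\<open>dominates_standard_cycle\<close>). Rotating the vertex weights leaves the density
  unchanged, and the arithmetic mean of the \<open>n\<close> rotated integrands is at least their geometric mean,
  in which all vertices carry the same weight \<open>\<phi>\<close>. With the kernel \<open>A(s,t) = \<phi>(s)^(1/2) g(s,t) \<phi>(t)^(1/2)\<close>,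
  the density becomes the trace of \<open>A\<^sup>n\<close>. Here the Gram representation of \<open>g\<close> enters: \<open>A = B B\<^sup>T\<close>, hence
  \<open>A\<^sup>n = C C\<^sup>T\<close> for some \<open>C\<close> (\<open>kpow_gram_is_gram\<close>), and the trace of \<open>C C\<^sup>T\<close> is at least the integral of
  \<open>C C\<^sup>T\<close> over the square (\<open>trace_gram_ge\<close>). The latter is the density of the path with \<open>n\<close> edges in the
  kernel \<open>A\<close>, so the tree case bounds it from below by the \<open>n\<close>-th power of the integral of \<open>A\<close>.
  
  It remains to see that leaves can be stripped off a tree until a single edge is left
  (\<open>tree_induct\<close>), and off a unicyclic graph until a cycle is left (\<open>unicyclic_induct\<close>).
  
  All inequalities are proved on a probability space, for kernels that are measurable with respect
  to the product sigma-algebra. Lebesgue measurable kernels on the unit square are more general, but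
  differ from Borel ones only on a null set; \<open>extra_goodI\<close> transfers the result.
\<close>

section \<open>Leaves and cycles in finite graphs\<close>

lemma simple_graph_edgeE:
  assumes "simple_graph V E" "e \<in> E"
  obtains u v where "e = {u, v}" "u \<noteq> v" "u \<in> V" "v \<in> V"
proof -
  have "card e = 2" "e \<subseteq> V" using assms by (auto simp: simple_graph_def)
  then show ?thesis using that by (auto simp: card_2_iff)
qed

lemma simple_graph_finite:
  assumes "simple_graph V E"
  shows "finite V" "finite E"
proof -
  show "finite V" using assms by (simp add: simple_graph_def)
  moreover have "E \<subseteq> Pow V" using assms by (auto simp: simple_graph_def)
  ultimately show "finite E" by (meson finite_Pow_iff finite_subset)
qed

lemma simple_graph_insert_leaf:
  assumes "simple_graph V E" "v \<in> V" "w \<notin> V"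
  shows "simple_graph (insert w V) (insert {v, w} E)" "{v, w} \<notin> E"
  using assms by (auto simp: simple_graph_def card_2_iff)

definition cycle_edges :: "nat \<Rightarrow> nat set set" where
  "cycle_edges n = (\<lambda>i. {i, Suc i mod n}) ` {..<n}"

text \<open>
  Both orders of the endpoints of an edge are covered by the quantifiers. Isolated vertices do not
  count as leaves.
\<close>

definition leafless :: "'a set set \<Rightarrow> bool" where
  "leafless E \<longleftrightarrow> (\<forall>u v. {u, v} \<in> E \<longrightarrow> (\<exists>w. w \<noteq> u \<and> {v, w} \<in> E))"

definition path_in :: "'a set set \<Rightarrow> 'a list \<Rightarrow> bool" where
  "path_in E p \<longleftrightarrow> distinct p \<and> (\<forall>i. Suc i < length p \<longrightarrow> {p ! i, p ! Suc i} \<in> E)"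

lemma path_in_Cons:
  assumes "path_in E p" "p \<noteq> []" "w \<notin> set p" "{w, hd p} \<in> E"
  shows "path_in E (w # p)"
  unfolding path_in_def
proof (intro conjI allI impI)
  show "distinct (w # p)" using assms by (simp add: path_in_def)
  fix i assume "Suc i < length (w # p)"
  then show "{(w # p) ! i, (w # p) ! Suc i} \<in> E"
    using assms by (cases i) (auto simp: path_in_def hd_conv_nth)
qed

text \<open>
  Consider a longest path. Its first vertex has a neighbour other than the second vertex; as the path
  cannot be prolonged, this neighbour lies on the path and closes an initial segment to a cycle.
\<close>

lemma leafless_imp_cycle:
  assumes G: "simple_graph V E" and "E \<noteq> {}" and leafless: "leafless E"
  shows "\<exists>c. cycle_in E c"
proof -
  have finV: "finite V" and EV: "\<And>e. e \<in> E \<Longrightarrow> e \<subseteq> V \<and> card e = 2"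
    using G by (auto simp: simple_graph_def)
  define P where "P = (\<lambda>p. path_in E p \<and> set p \<subseteq> V \<and> 2 \<le> length p)"
  obtain e where "e \<in> E" using \<open>E \<noteq> {}\<close> by auto
  then obtain a b where ab: "{a, b} \<in> E" "a \<noteq> b" using EV by (metis card_2_iff)
  then have "P [a, b]" using EV[of "{a, b}"] by (auto simp: P_def path_in_def less_Suc_eq)
  moreover have "length p < Suc (card V)" if "P p" for p
    using that finV by (metis P_def card_mono distinct_card path_in_def le_imp_less_Suc)
  ultimately obtain p where p: "P p" and max: "\<And>q. P q \<Longrightarrow> length q \<le> length p"
    using ex_has_greatest_nat[of P "[a, b]" length "Suc (card V)"] by blast
  define u where "u = p ! 1"
  define v where "v = p ! 0"
  have uv: "{u, v} \<in> E" using p by (auto simp: P_def path_in_def u_def v_def insert_commute)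
  then obtain w where w: "w \<noteq> u" "{v, w} \<in> E" using leafless by (auto simp: leafless_def)
  have wV: "w \<in> V" and wv: "w \<noteq> v" using EV[OF w(2)] by auto
  have pne: "p \<noteq> []" using p by (auto simp: P_def)
  have "w \<in> set p"
  proof (rule ccontr)
    assume "w \<notin> set p"
    then have "P (w # p)"
      using p wV pne w(2) by (auto simp: P_def v_def hd_conv_nth insert_commute intro!: path_in_Cons)
    from max[OF this] show False by simp
  qed
  then obtain j where j: "j < length p" "w = p ! j" by (auto simp: in_set_conv_nth)
  have j2: "2 \<le> j"
  proof -
    have "j \<noteq> 0" using j wv unfolding v_def by metis
    moreover have "j \<noteq> 1" using j w unfolding u_def by metis
    ultimately show ?thesis by simp
  qed
  define c where "c = take (Suc j) p"
  have len: "length c = Suc j" using j by (simp add: c_def)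
  have "cycle_in E c"
    unfolding cycle_in_def
  proof (intro conjI allI impI)
    show "3 \<le> length c" using j2 len by simp
    show "distinct c" using p by (simp add: c_def P_def path_in_def)
    fix i assume i: "i < length c"
    show "{c ! i, c ! (Suc i mod length c)} \<in> E"
    proof (cases "i = j")
      case True
      then show ?thesis using w(2) j by (simp add: len c_def v_def insert_commute)
    next
      case False
      then have "i < j" using i len by simp
      then show ?thesis using p j by (simp add: len c_def P_def path_in_def)
    qed
  qed
  then show ?thesis ..
qed

lemma not_leafless_imp_leaf:
  assumes G: "simple_graph V E" and "\<not> leafless E"
  shows "\<exists>v w. {v, w} \<in> E \<and> v \<noteq> w \<and> v \<in> V \<and> w \<in> V \<and> (\<forall>e\<in>E. w \<in> e \<longrightarrow> e = {v, w})"
proof -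
  obtain v w where vw: "{v, w} \<in> E" "\<And>x. x \<noteq> v \<Longrightarrow> {w, x} \<notin> E"
    using assms by (auto simp: leafless_def)
  have "v \<noteq> w" "v \<in> V" "w \<in> V" using G vw(1) by (auto simp: simple_graph_def)
  moreover have "e = {v, w}" if "e \<in> E" "w \<in> e" for e
  proof -
    have "card e = 2" using G \<open>e \<in> E\<close> by (auto simp: simple_graph_def)
    then obtain x where x: "e = {w, x}" using \<open>w \<in> e\<close> by (auto simp: card_2_iff)
    then have "x = v" using vw(2)[of x] \<open>e \<in> E\<close> x by blast
    with x show ?thesis by (simp add: insert_commute)
  qed
  ultimately show ?thesis using vw by blast
qed

text \<open>
  Mapping the leaf to its neighbour turns walks into walks that avoid the leaf edge.
\<close>

lemma connected_remove_leaf: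
  assumes G: "connected_graph V E" and leaf: "{v, w} \<in> E" "v \<noteq> w" "\<And>e. e \<in> E \<Longrightarrow> w \<in> e \<Longrightarrow> e = {v, w}"
  shows "connected_graph (V - {w}) (E - {{v, w}})"
proof -
  let ?E = "E - {{v, w}}"
  have simple: "simple_graph V E" and conn: "\<And>a b. a \<in> V \<Longrightarrow> b \<in> V \<Longrightarrow> (a, b) \<in> {(a, b). {a, b} \<in> E}\<^sup>*"
    using G by (auto simp: connected_graph_def)
  have v: "v \<in> V" using simple leaf(1) by (auto simp: simple_graph_def)
  have "simple_graph (V - {w}) ?E"
    using simple leaf(3) by (auto simp: simple_graph_def)
  \<comment> \<open>the retraction of the leaf onto its neighbour\<close>
  moreover define r where "r = (\<lambda>x. if x = w then v else x)"
  have "(r a, r b) \<in> {(a, b). {a, b} \<in> ?E}\<^sup>*" if "(a, b) \<in> {(a, b). {a, b} \<in> E}\<^sup>*" for a b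
    using that
  proof (induction rule: rtrancl_induct)
    case (step b c)
    then have bc: "{b, c} \<in> E" by simp
    show ?case
    proof (cases "w \<in> {b, c}")
      case True
      then have "{b, c} = {v, w}" using leaf(3)[OF bc] by simp
      then have "r b = r c" by (auto simp: r_def doubleton_eq_iff)
      then show ?thesis using step by simp
    next
      case False
      then have "(r b, r c) \<in> {(a, b). {a, b} \<in> ?E}" using bc by (auto simp: r_def)
      then show ?thesis by (rule rtrancl_into_rtrancl[OF step.IH])
    qed
  qed simp
  then have "(a, b) \<in> {(a, b). {a, b} \<in> ?E}\<^sup>*" if "a \<in> V - {w}" "b \<in> V - {w}" for a b
    using that conn[of a b] by (metis DiffD1 DiffD2 insertI1 r_def)
  ultimately show ?thesis using v leaf(2) by (auto simp: connected_graph_def)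
qed

text \<open>
  A tree with an edge is not leafless, since it would contain a cycle. The induction stops at a single
  edge and not at a single vertex, because the inequality concerns graphs with at least one edge only.
\<close>

lemma tree_induct [consumes 2, case_names edge leaf]:
  assumes "tree V E" "E \<noteq> {}"
    and edge: "\<And>u v. u \<noteq> v \<Longrightarrow> P {u, v} {{u, v}}"
    and leaf: "\<And>V E v w. simple_graph V E \<Longrightarrow> E \<noteq> {} \<Longrightarrow> v \<in> V \<Longrightarrow> w \<notin> V \<Longrightarrow> P V E
      \<Longrightarrow> P (insert w V) (insert {v, w} E)"
  shows "P V E"
  using assms(1,2)
proof (induction "card V" arbitrary: V E rule: less_induct)
  case less
  have conn: "connected_graph V E" and acyc: "\<nexists>c. cycle_in E c"
    using less.prems by (auto simp: tree_def)
  then have G: "simple_graph V E" by (simp add: connected_graph_def)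
  have "\<not> leafless E" using leafless_imp_cycle[OF G] less.prems acyc by blast
  from not_leafless_imp_leaf[OF G this] obtain v w where vw:
    "{v, w} \<in> E" "v \<noteq> w" "v \<in> V" "w \<in> V" "\<forall>e\<in>E. w \<in> e \<longrightarrow> e = {v, w}" by (elim exE conjE)
  let ?V = "V - {w}" and ?E = "E - {{v, w}}"
  have conn': "connected_graph ?V ?E"
    using vw(5) by (intro connected_remove_leaf[OF conn vw(1,2)]) blast
  then have G': "simple_graph ?V ?E" by (simp add: connected_graph_def)
  have acyc': "\<nexists>c. cycle_in ?E c" using acyc by (auto simp: cycle_in_def)
  have eq: "insert w ?V = V" "insert {v, w} ?E = E" using vw(1,4) by blast+
  show ?case
  proof (cases "?E = {}")
    case True
    have "x = v" if "x \<in> ?V" for x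
    proof -
      have "v \<in> ?V" using vw(2,3) by blast
      then have "(x, v) \<in> {(a, b). {a, b} \<in> ?E}\<^sup>*"
        using conn' that unfolding connected_graph_def by blast
      then show ?thesis unfolding True by simp
    qed
    then have "V = {v, w}" using vw(3,4) by blast
    moreover have "E = {{v, w}}" using True vw(1) by auto
    ultimately show ?thesis using edge[OF vw(2)] by simp
  next
    case False
    have "card ?V < card V" using vw(4) G by (intro psubset_card_mono) (auto simp: simple_graph_def)
    then have "P ?V ?E"
      using less.hyps[of ?V ?E] conn' acyc' False by (simp add: tree_def)
    from leaf[OF G' False _ _ this, of v w] show ?thesis using vw(2,3) eq by simp
  qed
qed

lemma handshake:
  assumes "simple_graph V E"
  shows "(\<Sum>v\<in>V. card {e \<in> E. v \<in> e}) = 2 * card E"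
proof -
  have fin: "finite V" "finite E"
    using assms by (auto dest: simple_graph_finite)
  have "(\<Sum>v\<in>V. card {e \<in> E. v \<in> e}) = (\<Sum>v\<in>V. \<Sum>e\<in>E. if v \<in> e then 1 else 0)"
    unfolding sum.inter_filter[OF fin(2), symmetric] by simp
  also have "\<dots> = (\<Sum>e\<in>E. \<Sum>v\<in>V. if v \<in> e then 1 else 0)" by (rule sum.swap)
  also have "\<dots> = (\<Sum>e\<in>E. 2)"
  proof (rule sum.cong)
    fix e assume "e \<in> E"
    then have e: "card e = 2" "e \<subseteq> V" using assms by (auto simp: simple_graph_def)
    then have "{v \<in> V. v \<in> e} = e" by blast
    with e show "(\<Sum>v\<in>V. if v \<in> e then 1 else 0) = (2::nat)"
      unfolding sum.inter_filter[OF fin(1), symmetric] by simp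
  qed simp
  finally show ?thesis by simp
qed

text \<open>
  All degrees are at least two, while the average degree is two by the handshake lemma.
\<close>

lemma leafless_unicyclic_degree:
  assumes G: "unicyclic V E" and leafless: "leafless E" and v: "v \<in> V"
  shows "card {e \<in> E. v \<in> e} = 2"
proof -
  have conn: "connected_graph V E" and card: "card E = card V" using G by (auto simp: unicyclic_def)
  then have simple: "simple_graph V E" by (simp add: connected_graph_def)
  then have fin: "finite V" "finite E"
    by (auto dest: simple_graph_finite)
  have "card V > 0" using fin v by (auto simp: card_gt_0_iff)
  then obtain e0 where e0: "e0 \<in> E" using card by fastforce
  have ge: "2 \<le> card {e \<in> E. u \<in> e}" if u: "u \<in> V" for u
  proof -
    have "\<exists>x. {x, u} \<in> E"
    proof -
      obtain a b where ab: "e0 = {a, b}" "a \<noteq> b" "a \<in> V"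
        using e0 simple by (force simp: simple_graph_def card_2_iff)
      have "(u, a) \<in> {(a, b). {a, b} \<in> E}\<^sup>*" using conn u ab by (auto simp: connected_graph_def)
      then show ?thesis
      proof (cases rule: converse_rtranclE)
        case base
        then show ?thesis using e0 ab by (auto simp: insert_commute)
      next
        case (step y)
        then show ?thesis by (auto simp: insert_commute)
      qed
    qed
    then obtain x where x: "{x, u} \<in> E" ..
    then obtain y where y: "y \<noteq> x" "{u, y} \<in> E" using leafless by (auto simp: leafless_def)
    have "{x, u} \<noteq> {u, y}" using y by (auto simp: doubleton_eq_iff)
    then have "card {{x, u}, {u, y}} = 2" by simp
    moreover have "card {{x, u}, {u, y}} \<le> card {e \<in> E. u \<in> e}"
      using x y fin by (intro card_mono) auto
    ultimately show ?thesis by simp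
  qed
  show ?thesis
  proof (rule ccontr)
    assume "card {e \<in> E. v \<in> e} \<noteq> 2"
    then have "2 < card {e \<in> E. v \<in> e}" using ge[OF v] by simp
    then have "(\<Sum>u\<in>V. 2) < (\<Sum>u\<in>V. card {e \<in> E. u \<in> e})"
      using fin ge v by (intro sum_strict_mono_ex1) auto
    then show False using handshake[OF simple] card by simp
  qed
qed

text \<open>
  At a vertex of a cycle the two cycle edges exhaust the degree. Hence no edge leaves the cycle, and by
  connectedness the cycle is the whole graph.
\<close>

lemma leafless_unicyclic_cycle:
  assumes G: "unicyclic V E" and leafless: "leafless E"
  obtains n \<sigma> where "3 \<le> n" "bij_betw \<sigma> {..<n} V" "E = (`) \<sigma> ` cycle_edges n"
proof -
  have conn: "connected_graph V E" and card: "card E = card V" using G by (auto simp: unicyclic_def)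
  then have simple: "simple_graph V E" by (simp add: connected_graph_def)
  then have fin: "finite V" "finite E"
    by (auto dest: simple_graph_finite)
  have "V \<noteq> {}" using conn by (simp add: connected_graph_def)
  then have "E \<noteq> {}" using card fin by (metis card_eq_0_iff)
  then obtain c where c: "cycle_in E c" using leafless_imp_cycle simple leafless by blast
  define n where "n = length c"
  define \<sigma> where "\<sigma> = (\<lambda>i. c ! i)"
  have n: "3 \<le> n" and inj: "inj_on \<sigma> {..<n}" and cyc: "\<And>i. i < n \<Longrightarrow> {\<sigma> i, \<sigma> (Suc i mod n)} \<in> E"
    using c by (auto simp: cycle_in_def n_def \<sigma>_def inj_on_nth)
  have nbr: "\<exists>i<n. e = {\<sigma> i, \<sigma> (Suc i mod n)}" if "i < n" "e \<in> E" "\<sigma> i \<in> e" for i e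
  proof -
    \<comment> \<open>the predecessor of \<open>i\<close> on the cycle; it differs from the successor since \<open>n \<ge> 3\<close>\<close>
    define j where "j = (i + n - 1) mod n"
    have j: "j < n" "Suc j mod n = i"
    proof -
      show "j < n" using n by (simp add: j_def)
      have "Suc j mod n = Suc (i + n - 1) mod n" unfolding j_def by (rule mod_Suc_eq)
      also have "\<dots> = i" using that n by simp
      finally show "Suc j mod n = i" .
    qed
    have ne: "j \<noteq> Suc i mod n"
    proof
      assume "j = Suc i mod n"
      then have "Suc (Suc i) mod n = i" using j(2) by (simp add: mod_Suc_eq)
      moreover have "Suc (Suc i) mod n = (if Suc (Suc i) < n then Suc (Suc i) else Suc (Suc i) - n)"
        using n that(1) by (simp add: le_mod_geq)
      ultimately show False using n that(1) by (simp split: if_splits)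
    qed
    have *: "\<sigma> j \<noteq> \<sigma> (Suc i mod n)"
      using ne inj j(1) n by (auto simp: inj_on_def)
    let ?S = "{{\<sigma> j, \<sigma> i}, {\<sigma> i, \<sigma> (Suc i mod n)}}"
    have "{\<sigma> i, \<sigma> (Suc i mod n)} \<in> E" "{\<sigma> j, \<sigma> i} \<in> E" using cyc that(1) cyc[OF j(1)] j(2) by auto
    then have "?S \<subseteq> {e \<in> E. \<sigma> i \<in> e}" by auto
    moreover have "card {e \<in> E. \<sigma> i \<in> e} = 2"
      using that simple by (intro leafless_unicyclic_degree[OF G leafless]) (auto simp: simple_graph_def)
    moreover have "card ?S = 2"
    proof -
      have "{\<sigma> j, \<sigma> i} \<noteq> {\<sigma> i, \<sigma> (Suc i mod n)}" using * by (auto simp: doubleton_eq_iff)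
      then show ?thesis by simp
    qed
    ultimately have "?S = {e \<in> E. \<sigma> i \<in> e}"
      using fin by (intro card_subset_eq) auto
    then have "e \<in> ?S" using that by blast
    then show ?thesis using j that(1) by auto
  qed
  have sub: "\<sigma> ` {..<n} \<subseteq> V"
    using cyc simple by (force simp: simple_graph_def)
  have "x \<in> \<sigma> ` {..<n}" if "(\<sigma> 0, x) \<in> {(a, b). {a, b} \<in> E}\<^sup>*" for x
    using that
  proof (induction rule: rtrancl_induct)
    case (step y z)
    then obtain i where i: "i < n" "y = \<sigma> i" by auto
    from step have "{y, z} \<in> E" by simp
    from nbr[OF i(1) this] i obtain k where "k < n" "{y, z} = {\<sigma> k, \<sigma> (Suc k mod n)}" by auto
    moreover have "Suc k mod n < n" using n by simp
    ultimately show ?case by (auto simp: doubleton_eq_iff)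
  qed (use n in auto)
  moreover have "\<sigma> 0 \<in> V" using sub n by auto
  ultimately have V: "\<sigma> ` {..<n} = V"
    using sub conn by (auto simp: connected_graph_def)
  have "E = (\<lambda>i. {\<sigma> i, \<sigma> (Suc i mod n)}) ` {..<n}"
  proof (intro equalityI subsetI)
    fix e assume e: "e \<in> E"
    then obtain x where "x \<in> e" "x \<in> V" using simple by (force simp: simple_graph_def card_2_iff)
    then show "e \<in> (\<lambda>i. {\<sigma> i, \<sigma> (Suc i mod n)}) ` {..<n}" using nbr e V by blast
  qed (use cyc in auto)
  then have "E = (`) \<sigma> ` cycle_edges n" by (simp add: cycle_edges_def image_image)
  then show ?thesis using that n inj V by (auto simp: bij_betw_def)
qed

text \<open>
  Removing a leaf lowers the numbers of vertices and of edges by one each, so the graph stays unicyclic.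
\<close>

lemma unicyclic_induct [consumes 1, case_names cycle leaf]:
  assumes "unicyclic V E"
    and cycle: "\<And>n \<sigma> V. 3 \<le> n \<Longrightarrow> bij_betw \<sigma> {..<n} V \<Longrightarrow> P V ((`) \<sigma> ` cycle_edges n)"
    and leaf: "\<And>V E v w. simple_graph V E \<Longrightarrow> E \<noteq> {} \<Longrightarrow> v \<in> V \<Longrightarrow> w \<notin> V \<Longrightarrow> P V E
      \<Longrightarrow> P (insert w V) (insert {v, w} E)"
  shows "P V E"
  using assms(1)
proof (induction "card V" arbitrary: V E rule: less_induct)
  case less
  have conn: "connected_graph V E" and card: "card E = card V" 
    using less.prems by (auto simp: unicyclic_def)
  then have G: "simple_graph V E" by (simp add: connected_graph_def)
  have fin: "finite V" "finite E"
    using G by (auto dest: simple_graph_finite)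
  show ?case
  proof (cases "leafless E")
    case True
    obtain n \<sigma> where "3 \<le> n" "bij_betw \<sigma> {..<n} V" "E = (`) \<sigma> ` cycle_edges n"
      using leafless_unicyclic_cycle[OF less.prems True] .
    then show ?thesis using cycle by simp
  next
    case False
    from not_leafless_imp_leaf[OF G this] obtain v w where vw:
      "{v, w} \<in> E" "v \<noteq> w" "v \<in> V" "w \<in> V" "\<forall>e\<in>E. w \<in> e \<longrightarrow> e = {v, w}" by (elim exE conjE)
    let ?V = "V - {w}" and ?E = "E - {{v, w}}"
    have conn': "connected_graph ?V ?E"
      using vw(5) by (intro connected_remove_leaf[OF conn vw(1,2)]) blast
    then have G': "simple_graph ?V ?E" by (simp add: connected_graph_def)
    have "card ?V < card V" using vw(4) fin by (intro psubset_card_mono) auto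
    moreover have uni: "unicyclic ?V ?E" using conn' vw(1,4) card fin by (simp add: unicyclic_def)
    ultimately have "P ?V ?E" by (rule less.hyps)
    moreover have "?E \<noteq> {}"
    proof
      assume "?E = {}"
      moreover have "card ?E = card ?V" using uni by (simp add: unicyclic_def)
      ultimately have "card ?V = 0" by (metis card.empty)
      moreover have "v \<in> ?V" using vw(2,3) by blast
      ultimately show False using fin by auto
    qed
    moreover have "insert w ?V = V" "insert {v, w} ?E = E" using vw(1,4) by blast+
    ultimately show ?thesis using leaf[OF G', of v w] vw(2,3) by simp
  qed
qed

section \<open>Bounded measurable functions\<close>

text \<open>
  The bound is required everywhere and not only on \<open>space N\<close>, which saves side conditions. Functions
  given on the unit interval are extended by zero.
\<close>

definition bounded_borel :: "'b measure \<Rightarrow> ('b \<Rightarrow> real) \<Rightarrow> bool" where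
  "bounded_borel N f \<longleftrightarrow> f \<in> borel_measurable N \<and> (\<exists>C. \<forall>x. \<bar>f x\<bar> \<le> C)"

lemma bounded_borelI:
  "f \<in> borel_measurable N \<Longrightarrow> (\<And>x. \<bar>f x\<bar> \<le> C) \<Longrightarrow> bounded_borel N f"
  unfolding bounded_borel_def by blast

lemma bounded_borel_measurable [measurable_dest]:
  "bounded_borel N f \<Longrightarrow> f \<in> borel_measurable N"
  unfolding bounded_borel_def by blast

lemma bounded_borel_bound:
  assumes "bounded_borel N f"
  obtains C where "0 \<le> C" "\<And>x. \<bar>f x\<bar> \<le> C"
  using assms unfolding bounded_borel_def by (metis abs_ge_zero order_trans)

lemma bounded_borel_const [simp]: "bounded_borel N (\<lambda>_. c)"
  by (rule bounded_borelI[where C = "\<bar>c\<bar>"]) auto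

lemma bounded_borel_add:
  assumes "bounded_borel N f" "bounded_borel N f'"
  shows "bounded_borel N (\<lambda>x. f x + f' x)"
proof -
  obtain C where C: "\<And>x. \<bar>f x\<bar> \<le> C" using bounded_borel_bound[OF assms(1)] by blast
  obtain D where D: "\<And>x. \<bar>f' x\<bar> \<le> D" using bounded_borel_bound[OF assms(2)] by blast
  have "\<bar>f x + f' x\<bar> \<le> C + D" for x
    using abs_triangle_ineq[of "f x" "f' x"] C[of x] D[of x] by linarith
  with assms show ?thesis by (intro bounded_borelI) auto
qed

lemma bounded_borel_mult:
  assumes "bounded_borel N f" "bounded_borel N f'"
  shows "bounded_borel N (\<lambda>x. f x * f' x)"
proof -
  obtain C where C: "0 \<le> C" "\<And>x. \<bar>f x\<bar> \<le> C" using bounded_borel_bound[OF assms(1)] by blast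
  obtain D where D: "\<And>x. \<bar>f' x\<bar> \<le> D" using bounded_borel_bound[OF assms(2)] by blast
  have "\<bar>f x * f' x\<bar> \<le> C * D" for x
    unfolding abs_mult by (intro mult_mono C D) auto
  with assms show ?thesis by (intro bounded_borelI) auto
qed

lemma bounded_borel_prod:
  "(\<And>i. i \<in> I \<Longrightarrow> bounded_borel N (f i)) \<Longrightarrow> bounded_borel N (\<lambda>x. \<Prod>i\<in>I. f i x)"
  by (induction I rule: infinite_finite_induct) (auto intro: bounded_borel_mult)

lemma bounded_borel_powr:
  assumes "bounded_borel N f" "\<And>x. 0 \<le> f x" "0 \<le> a"
  shows "bounded_borel N (\<lambda>x. f x powr a)"
proof -
  obtain C where *: "\<And>x. \<bar>f x\<bar> \<le> C"
    using bounded_borel_bound[OF assms(1)] by blast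
  have "\<bar>f x powr a\<bar> \<le> C powr a" for x
    using assms(2)[of x] *[of x] assms(3) by (auto intro: powr_mono2)
  with assms(1) show ?thesis by (intro bounded_borelI) auto
qed

lemma bounded_borel_compose:
  assumes "bounded_borel N f" "h \<in> measurable L N"
  shows "bounded_borel L (\<lambda>x. f (h x))"
  using assms unfolding bounded_borel_def by (auto intro: measurable_compose)

lemma (in finite_measure) integrable_bounded_borel:
  assumes "bounded_borel M f" shows "integrable M f"
proof -
  obtain C where "\<And>x. \<bar>f x\<bar> \<le> C" using bounded_borel_bound[OF assms] by blast
  then show ?thesis
    using bounded_borel_measurable[OF assms] by (intro integrable_const_bound[where B = C]) auto
qed

lemma (in prob_space) bounded_borel_integral:
  assumes "bounded_borel (N \<Otimes>\<^sub>M M) f"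
  shows "bounded_borel N (\<lambda>x. \<integral>y. f (x, y) \<partial>M)"
proof -
  obtain C where *: "0 \<le> C" "\<And>x. \<bar>f x\<bar> \<le> C"
    using bounded_borel_bound[OF assms(1)] by blast
  have "\<bar>\<integral>y. f (x, y) \<partial>M\<bar> \<le> C" for x
  proof (cases "integrable M (\<lambda>y. f (x, y))")
    case True
    have "\<bar>\<integral>y. f (x, y) \<partial>M\<bar> \<le> (\<integral>y. \<bar>f (x, y)\<bar> \<partial>M)"
      by (rule integral_abs_bound)
    also have "\<dots> \<le> C"
      using True * by (intro integral_le_const) auto
    finally show ?thesis .
  qed (use * in \<open>simp add: not_integrable_integral_eq\<close>)
  moreover have "f \<in> borel_measurable (N \<Otimes>\<^sub>M M)"
    using assms by measurable
  then have "(\<lambda>x. \<integral>y. f (x, y) \<partial>M) \<in> borel_measurable N" by measurable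
  ultimately show ?thesis by (intro bounded_borelI)
qed

section \<open>Weighted homomorphism densities\<close>

text \<open>
  The left-hand side of the inequality, with a product measure in place of its completion.
\<close>

definition hom_density :: "real measure \<Rightarrow> 'a set \<Rightarrow> 'a set set \<Rightarrow> (real \<times> real \<Rightarrow> real) \<Rightarrow> ('a \<Rightarrow> real \<Rightarrow> real) \<Rightarrow> real"
  where "hom_density M V E g f =
    (\<integral>x. (\<Prod>e\<in>E. edge_value g x e) * (\<Prod>v\<in>V. f v (x v)) \<partial>(\<Pi>\<^sub>M v\<in>V. M))"

definition symmetric_kernel :: "(real \<times> real \<Rightarrow> real) \<Rightarrow> bool" where
  "symmetric_kernel g \<longleftrightarrow> (\<forall>s t. g (s, t) = g (t, s))"

lemma edge_value_eq:
  assumes "g (x u, x v) = g (x v, x u)"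
  shows "edge_value g x {u, v} = g (x u, x v)"
  unfolding edge_value_def using assms by (intro the_equality) (auto simp: doubleton_eq_iff)

lemma edge_value_pair: "symmetric_kernel g \<Longrightarrow> edge_value g x {u, v} = g (x u, x v)"
  by (rule edge_value_eq) (simp add: symmetric_kernel_def)

lemma edge_value_cong:
  assumes "\<And>v. v \<in> e \<Longrightarrow> x v = y v"
  shows "edge_value g x e = edge_value g y e"
proof -
  have "(\<forall>u v. e = {u, v} \<longrightarrow> c = g (x u, x v)) \<longleftrightarrow> (\<forall>u v. e = {u, v} \<longrightarrow> c = g (y u, y v))" for c
    using assms by auto
  then show ?thesis unfolding edge_value_def by presburger
qed

locale real_prob_space = prob_space M for M :: "real measure"
begin

sublocale square: pair_prob_space M M ..

sublocale cube: product_sigma_finite "\<lambda>_. M"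
  by unfold_locales

abbreviation "cube V \<equiv> (\<Pi>\<^sub>M v\<in>V. M)"

lemma prob_space_cube: "prob_space (cube V)"
  by (rule prob_space_PiM) unfold_locales

lemma integrable_cube: "bounded_borel (cube V) F \<Longrightarrow> integrable (cube V) F"
  using prob_space_cube[of V] by (simp add: finite_measure.integrable_bounded_borel prob_space_def)

lemma bounded_borel_edge_value:
  assumes "symmetric_kernel g" "bounded_borel (M \<Otimes>\<^sub>M M) g" "simple_graph V E" "e \<in> E"
  shows "bounded_borel (cube V) (\<lambda>x. edge_value g x e)"
proof -
  obtain u v where e: "e = {u, v}" "u \<in> V" "v \<in> V"
    using assms by (meson simple_graph_edgeE)
  have "bounded_borel (cube V) (\<lambda>x. g (x u, x v))"
    using e by (intro bounded_borel_compose[OF assms(2)]) measurable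
  moreover have "edge_value g x e = g (x u, x v)" for x
    using assms(1) e edge_value_eq by (metis symmetric_kernel_def)
  ultimately show ?thesis by simp
qed

lemma bounded_borel_component:
  "bounded_borel M f \<Longrightarrow> v \<in> V \<Longrightarrow> bounded_borel (cube V) (\<lambda>x. f (x v))"
  by (erule bounded_borel_compose) measurable

lemma bounded_borel_integrand:
  assumes "symmetric_kernel g" "bounded_borel (M \<Otimes>\<^sub>M M) g" "simple_graph V E"
    and "\<And>v. v \<in> V \<Longrightarrow> bounded_borel M (f v)"
  shows "bounded_borel (cube V) (\<lambda>x. (\<Prod>e\<in>E. edge_value g x e) * (\<Prod>v\<in>V. f v (x v)))"
  using assms
  by (intro bounded_borel_mult bounded_borel_prod bounded_borel_edge_value bounded_borel_component)

text \<open>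
  The coordinate of the leaf occurs in the factor \<open>g (x v, x w) * f w (x w)\<close> only and can be
  integrated out; the result is a factor that depends on the coordinate of \<open>v\<close>.
\<close>

lemma hom_density_insert_leaf:
  assumes g: "symmetric_kernel g" "bounded_borel (M \<Otimes>\<^sub>M M) g"
    and G: "simple_graph V E" "v \<in> V" "w \<notin> V"
    and f: "\<And>u. u \<in> insert w V \<Longrightarrow> bounded_borel M (f u)"
  shows "hom_density M (insert w V) (insert {v, w} E) g f =
    hom_density M V E g (f(v := \<lambda>s. f v s * (\<integral>t. g (s, t) * f w t \<partial>M)))"
proof -
  note fin = simple_graph_finite[OF G(1)]
  note G' = simple_graph_insert_leaf[OF G]
  let ?F = "\<lambda>x. (\<Prod>e\<in>insert {v, w} E. edge_value g x e) * (\<Prod>u\<in>insert w V. f u (x u))"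
  let ?f = "f(v := \<lambda>s. f v s * (\<integral>t. g (s, t) * f w t \<partial>M))"
  have inner: "(\<integral>y. ?F (x(w := y)) \<partial>M) = (\<Prod>e\<in>E. edge_value g x e) * (\<Prod>u\<in>V. ?f u (x u))" for x
  proof -
    have "?F (x(w := y)) = ((\<Prod>e\<in>E. edge_value g x e) * (\<Prod>u\<in>V. f u (x u))) * (g (x v, y) * f w y)" for y
    proof -
      have "edge_value g (x(w := y)) {v, w} = g (x v, y)"
        using g(1) G(2,3) by (subst edge_value_eq) (auto simp: symmetric_kernel_def)
      moreover have "(\<Prod>e\<in>E. edge_value g (x(w := y)) e) = (\<Prod>e\<in>E. edge_value g x e)"
        using G by (intro prod.cong edge_value_cong) (auto simp: simple_graph_def)
      moreover have "(\<Prod>u\<in>V. f u ((x(w := y)) u)) = (\<Prod>u\<in>V. f u (x u))"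
        using G(3) by (intro prod.cong) auto
      ultimately show ?thesis using fin G(3) G'(2) by simp
    qed
    then have "(\<integral>y. ?F (x(w := y)) \<partial>M) =
        (\<Prod>e\<in>E. edge_value g x e) * ((\<Prod>u\<in>V. f u (x u)) * (\<integral>t. g (x v, t) * f w t \<partial>M))"
      by simp
    also have "(\<Prod>u\<in>V. f u (x u)) * (\<integral>t. g (x v, t) * f w t \<partial>M) = (\<Prod>u\<in>V. ?f u (x u))"
      using fin G(2) by (simp add: prod.remove[of V v] mult_ac)
    finally show ?thesis .
  qed
  have "integrable (cube (insert w V)) ?F"
    using f G'(1) g by (intro integrable_cube bounded_borel_integrand)
  then have "(\<integral>x. ?F x \<partial>cube (insert w V)) = (\<integral>x. (\<integral>y. ?F (x(w := y)) \<partial>M) \<partial>cube V)"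
    by (intro cube.product_integral_insert fin G)
  then show ?thesis unfolding hom_density_def inner .
qed

lemma hom_density_single:
  assumes "bounded_borel M (f u)"
  shows "hom_density M {u} {} g f = (\<integral>s. f u s \<partial>M)"
  unfolding hom_density_def using assms cube.product_integral_singleton[of "f u" u]
  by (simp add: bounded_borel_measurable)

lemma integral_square:
  assumes "bounded_borel (M \<Otimes>\<^sub>M M) F"
  shows "(\<integral>p. F p \<partial>(M \<Otimes>\<^sub>M M)) = (\<integral>s. (\<integral>t. F (s, t) \<partial>M) \<partial>M)"
  using square.integral_fst'[OF square.P.integrable_bounded_borel[OF assms]] by simp

lemma integral_square_swap:
  assumes "bounded_borel (M \<Otimes>\<^sub>M M) F"
  shows "(\<integral>(s, t). F (t, s) \<partial>(M \<Otimes>\<^sub>M M)) = (\<integral>p. F p \<partial>(M \<Otimes>\<^sub>M M))"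
  using square.integral_product_swap[of F] assms by (simp add: bounded_borel_measurable)

end

section \<open>Edges and leaves\<close>

text \<open>
  The inequality of extra-good graphs for one kernel on a probability space.
\<close>

definition dominates :: "real measure \<Rightarrow> (real \<times> real \<Rightarrow> real) \<Rightarrow> 'a set \<Rightarrow> 'a set set \<Rightarrow> bool" where
  "dominates M g V E \<longleftrightarrow> (\<forall>f. (\<forall>v\<in>V. bounded_borel M (f v) \<and> (\<forall>t. 0 \<le> f v t)) \<longrightarrow>
     (\<integral>(s, t). vertex_mean V E f s * g (s, t) * vertex_mean V E f t \<partial>(M \<Otimes>\<^sub>M M)) ^ card E
       \<le> hom_density M V E g f)"

text \<open>
  Hoelder's inequality in pointwise form. If \<open>X\<close> has an integral below \<open>t\<close> and \<open>Y\<close> one of at most \<open>1\<close>,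
  then integrating bounds the integral of the left-hand side by \<open>t powr \<theta>\<close>. A threshold \<open>t > 0\<close> instead of
  the integral of \<open>X\<close> itself avoids a case distinction when that integral vanishes.
\<close>

lemma powr_AM_GM_threshold:
  fixes X Y t \<theta> :: real
  assumes "0 \<le> X" "0 \<le> Y" "0 < t" "0 < \<theta>" "\<theta> < 1"
  shows "X powr \<theta> * Y powr (1 - \<theta>) \<le> t powr \<theta> * (\<theta> * (X / t) + (1 - \<theta>) * Y)"
proof (cases "X = 0 \<or> Y = 0")
  case False
  have "(X / t) powr \<theta> * Y powr (1 - \<theta>) \<le> \<theta> * (X / t) + (1 - \<theta>) * Y"
    using assms False by (intro Youngs_inequality_0) auto
  moreover have "X powr \<theta> = t powr \<theta> * (X / t) powr \<theta>"
    using assms by (simp flip: powr_mult)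
  ultimately show ?thesis
    using assms by (simp add: mult.assoc mult_left_mono)
qed (use assms in auto)

lemma vertex_mean_nonneg [simp]: "0 \<le> vertex_mean V E f t"
  by (simp add: vertex_mean_def)

locale nonneg_kernel = real_prob_space +
  fixes g :: "real \<times> real \<Rightarrow> real"
  assumes sym: "symmetric_kernel g"
    and bounded: "bounded_borel (M \<Otimes>\<^sub>M M) g"
    and nonneg: "\<And>p. 0 \<le> g p"
begin

lemma g_swap: "g (s, t) = g (t, s)"
  using sym by (simp add: symmetric_kernel_def)

lemma bounded_fst: "bounded_borel M f \<Longrightarrow> bounded_borel (M \<Otimes>\<^sub>M M) (\<lambda>p. f (fst p))"
  by (erule bounded_borel_compose) measurable

lemma bounded_snd: "bounded_borel M f \<Longrightarrow> bounded_borel (M \<Otimes>\<^sub>M M) (\<lambda>p. f (snd p))"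
  by (erule bounded_borel_compose) measurable

lemma bounded_weighted:
  assumes "bounded_borel M a" "bounded_borel M b"
  shows "bounded_borel (M \<Otimes>\<^sub>M M) (\<lambda>(s, t). a s * g (s, t) * b t)"
proof -
  have "bounded_borel (M \<Otimes>\<^sub>M M) (\<lambda>p. a (fst p) * g p * b (snd p))"
    using assms by (intro bounded_borel_mult bounded bounded_fst bounded_snd)
  then show ?thesis by (simp add: case_prod_unfold)
qed

lemma bounded_vertex_mean:
  assumes "finite V" "\<And>v. v \<in> V \<Longrightarrow> bounded_borel M (f v) \<and> (\<forall>t. 0 \<le> f v t)"
  shows "bounded_borel M (vertex_mean V E f)"
  unfolding vertex_mean_def using assms
  by (intro bounded_borel_powr bounded_borel_prod prod_nonneg) auto

text \<open>
  For the mean \<open>m\<close> of the two weights, \<open>m s * m t\<close> is the geometric mean of \<open>f u s * f v t\<close> and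
  \<open>f v s * f u t\<close>. Integrated against the symmetric kernel \<open>g\<close>, both give the density of the edge.
\<close>

lemma dominates_edge:
  assumes "u \<noteq> v"
  shows "dominates M g {u, v} {{u, v}}"
  unfolding dominates_def
proof (intro allI impI)
  fix f :: "'a \<Rightarrow> real \<Rightarrow> real"
  assume f: "\<forall>w\<in>{u, v}. bounded_borel M (f w) \<and> (\<forall>t. 0 \<le> f w t)"
  let ?m = "vertex_mean {u, v} {{u, v}} f"
  let ?D = "\<lambda>(s, t). f u s * g (s, t) * f v t"
  have m: "?m s = sqrt (f u s * f v s)" for s
    using assms f by (simp add: vertex_mean_def powr_half_sqrt)
  have bm: "bounded_borel M ?m" by (rule bounded_vertex_mean) (use f in auto)
  have D: "bounded_borel (M \<Otimes>\<^sub>M M) ?D" using f by (intro bounded_weighted) auto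
  have D': "bounded_borel (M \<Otimes>\<^sub>M M) (\<lambda>(s, t). ?D (t, s))"
    using bounded_weighted[of "f v" "f u"] f by (simp add: g_swap mult_ac)
  have "hom_density M {u, v} {{u, v}} g f = hom_density M (insert v {u}) (insert {u, v} {}) g f"
    by (simp add: insert_commute)
  also have "\<dots> = hom_density M {u} {} g (f(u := \<lambda>s. f u s * (\<integral>t. g (s, t) * f v t \<partial>M)))"
    using assms f by (intro hom_density_insert_leaf sym bounded) (auto simp: simple_graph_def)
  also have "\<dots> = (\<integral>s. f u s * (\<integral>t. g (s, t) * f v t \<partial>M) \<partial>M)"
  proof (subst hom_density_single)
    have "bounded_borel (M \<Otimes>\<^sub>M M) (\<lambda>p. g p * f v (snd p))"
      using f by (intro bounded_borel_mult bounded bounded_snd) auto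
    from bounded_borel_integral[OF this]
    show "bounded_borel M ((f(u := \<lambda>s. f u s * (\<integral>t. g (s, t) * f v t \<partial>M))) u)"
      using f by (auto intro: bounded_borel_mult)
  qed simp
  also have "\<dots> = (\<integral>p. ?D p \<partial>(M \<Otimes>\<^sub>M M))"
    by (subst integral_square[OF D]) (simp add: mult.assoc)
  finally have dens: "hom_density M {u, v} {{u, v}} g f = (\<integral>p. ?D p \<partial>(M \<Otimes>\<^sub>M M))" .
  have "(\<integral>(s, t). ?m s * g (s, t) * ?m t \<partial>(M \<Otimes>\<^sub>M M))
      \<le> (\<integral>p. (?D p + (\<lambda>(s, t). ?D (t, s)) p) / 2 \<partial>(M \<Otimes>\<^sub>M M))"
  proof (rule integral_mono)
    show "integrable (M \<Otimes>\<^sub>M M) (\<lambda>(s, t). ?m s * g (s, t) * ?m t)"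
      using bm by (intro square.P.integrable_bounded_borel bounded_weighted)
    show "integrable (M \<Otimes>\<^sub>M M) (\<lambda>p. (?D p + (\<lambda>(s, t). ?D (t, s)) p) / 2)"
      using D D' by (intro integrable_divide Bochner_Integration.integrable_add square.P.integrable_bounded_borel) auto
    fix p :: "real \<times> real"
    obtain s t where p: "p = (s, t)" by (cases p)
    have "?m s * ?m t = sqrt ((f u s * f v t) * (f v s * f u t))"
      unfolding m by (simp add: mult_ac flip: real_sqrt_mult)
    also have "\<dots> \<le> (f u s * f v t + f v s * f u t) / 2"
      using f by (intro arith_geo_mean_sqrt mult_nonneg_nonneg) auto
    finally have "g (s, t) * (?m s * ?m t) \<le> g (s, t) * ((f u s * f v t + f v s * f u t) / 2)"
      using nonneg by (rule mult_left_mono)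
    then show "(\<lambda>(s, t). ?m s * g (s, t) * ?m t) p \<le> (?D p + (\<lambda>(s, t). ?D (t, s)) p) / 2"
      by (simp add: p g_swap[of t s] algebra_simps)
  qed
  also have "\<dots> = ((\<integral>p. ?D p \<partial>(M \<Otimes>\<^sub>M M)) + (\<integral>(s, t). ?D (t, s) \<partial>(M \<Otimes>\<^sub>M M))) / 2"
    using D D' square.P.integrable_bounded_borel
    by (subst integral_divide_zero, subst Bochner_Integration.integral_add) auto
  also have "\<dots> = (\<integral>p. ?D p \<partial>(M \<Otimes>\<^sub>M M))"
    using integral_square_swap[OF D] by simp
  finally show "(\<integral>(s, t). ?m s * g (s, t) * ?m t \<partial>(M \<Otimes>\<^sub>M M)) ^ card {{u, v}}
      \<le> hom_density M {u, v} {{u, v}} g f"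
    by (simp add: dens)
qed

text \<open>
  The density is linear in the weight of \<open>v\<close>. This shows that adding a small constant to a factor of
  this weight, to make it positive, changes the density only little.
\<close>

lemma hom_density_add_weight:
  assumes G: "simple_graph V E" "v \<in> V"
    and f: "\<And>u. u \<in> V \<Longrightarrow> bounded_borel M (f u)" and a: "bounded_borel M a"
  shows "hom_density M V E g (f(v := \<lambda>s. f v s * (a s + c))) =
    hom_density M V E g (f(v := \<lambda>s. f v s * a s)) + c * hom_density M V E g f"
proof -
  note fin = simple_graph_finite[OF G(1)]
  let ?I = "\<lambda>f x. (\<Prod>e\<in>E. edge_value g x e) * (\<Prod>u\<in>V. f u (x u))"
  have int: "integrable (cube V) (?I h)" if "\<And>u. u \<in> V \<Longrightarrow> bounded_borel M (h u)" for h
    using that G by (intro integrable_cube bounded_borel_integrand sym bounded)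
  have "(\<Prod>u\<in>V. (f(v := h)) u (x u)) = h (x v) * (\<Prod>u\<in>V - {v}. f u (x u))" for h x
    using fin G(2) by (subst prod.remove[of V v]) (auto intro!: prod.cong)
  moreover have "(\<Prod>u\<in>V. f u (x u)) = f v (x v) * (\<Prod>u\<in>V - {v}. f u (x u))" for x
    using fin G(2) by (subst prod.remove[of V v]) auto
  ultimately have "?I (f(v := \<lambda>s. f v s * (a s + c))) x
      = ?I (f(v := \<lambda>s. f v s * a s)) x + c * ?I f x" for x
    by (simp add: algebra_simps)
  moreover have "(\<integral>x. ?I (f(v := \<lambda>s. f v s * a s)) x + c * ?I f x \<partial>cube V)
      = (\<integral>x. ?I (f(v := \<lambda>s. f v s * a s)) x \<partial>cube V) + c * (\<integral>x. ?I f x \<partial>cube V)"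
  proof (subst Bochner_Integration.integral_add)
    show "integrable (cube V) (?I (f(v := \<lambda>s. f v s * a s)))"
      using f a G(2) by (intro int) (auto intro: bounded_borel_mult)
    show "integrable (cube V) (\<lambda>x. c * ?I f x)"
      using f by (intro integrable_mult_right int) auto
  qed simp
  ultimately show ?thesis unfolding hom_density_def by simp
qed

end

lemma real_le_of_right_limit:
  fixes h :: "real \<Rightarrow> real"
  assumes "isCont h a" "\<And>t. a < t \<Longrightarrow> c \<le> h t"
  shows "c \<le> h a"
proof (rule tendsto_lowerbound)
  show "(h \<longlongrightarrow> h a) (at_right a)"
    using assms(1) by (simp add: filterlim_at_split isCont_def)
  show "\<forall>\<^sub>F t in at_right a. c \<le> h t"
    using assms(2) by (auto simp: eventually_at_right_field intro: exI[of _ "a + 1"])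
qed simp

context nonneg_kernel
begin

text \<open>
  Let \<open>Q s\<close> be the integral of \<open>g (s, t) * f w t\<close> over \<open>t\<close>, the factor that the leaf contributes to the
  weight of \<open>v\<close>. The mean \<open>\<psi>\<close> of the weights of the larger graph and the mean \<open>\<phi>\<close> of those of the smaller
  one are related by
  \<open>\<psi> s * \<psi> t = (\<phi> s * \<phi> t) powr \<theta> * Y powr (1 - \<theta>)\<close>, where \<open>\<theta> = e / (e + 1)\<close> and \<open>Y\<close> is the geometric mean of
  \<open>f w s / Q t\<close> and \<open>f w t / Q s\<close>. Integrated against \<open>g\<close>, each of these two quotients gives at most \<open>1\<close>, by
  the choice of \<open>Q\<close>, so Hoelder's inequality bounds the integral of \<open>\<psi> s * g (s, t) * \<psi> t\<close> by the
  \<open>\<theta>\<close>-th power of that of \<open>\<phi> s * g (s, t) * \<phi> t\<close>. As \<open>Q\<close> may vanish, it is replaced by \<open>Q + \<epsilon>\<close>, and \<open>\<epsilon>\<close>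
  tends to zero at the end.
\<close>

lemma dominates_add_leaf:
  assumes G: "simple_graph V E" "E \<noteq> {}" "v \<in> V" "w \<notin> V"
    and dom: "dominates M g V E"
  shows "dominates M g (insert w V) (insert {v, w} E)"
  unfolding dominates_def
proof (intro allI impI)
  fix f :: "'a \<Rightarrow> real \<Rightarrow> real"
  assume f: "\<forall>u\<in>insert w V. bounded_borel M (f u) \<and> (\<forall>t. 0 \<le> f u t)"
  note fin = simple_graph_finite[OF G(1)]
  define e where "e = card E"
  define \<theta> where "\<theta> = real e / (real e + 1)"
  define q where "q = f w"
  define Q where "Q = (\<lambda>s. \<integral>t. g (s, t) * q t \<partial>M)"
  define P where "P = (\<lambda>s. \<Prod>u\<in>V. f u s)"
  define \<psi> where "\<psi> = vertex_mean (insert w V) (insert {v, w} E) f"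
  define I where "I = (\<integral>(s, t). \<psi> s * g (s, t) * \<psi> t \<partial>(M \<Otimes>\<^sub>M M))"
  define D where "D = hom_density M V E g f"
  define D' where "D' = hom_density M V E g (f(v := \<lambda>s. f v s * Q s))"
  have e: "0 < e" using fin G(2) by (simp add: e_def card_gt_0_iff)
  then have \<theta>: "0 < \<theta>" "\<theta> < 1" by (simp_all add: \<theta>_def)
  have card: "card (insert {v, w} E) = Suc e"
    using fin simple_graph_insert_leaf(2)[OF G(1,3,4)] by (simp add: e_def)
  have q0: "0 \<le> q s" and P0: "0 \<le> P s" for s
    using f by (auto simp: q_def P_def intro!: prod_nonneg)
  have Q0: "0 \<le> Q s" for s
    using q0 nonneg by (auto simp: Q_def intro!: Bochner_Integration.integral_nonneg)
  have bq: "bounded_borel M q" using f by (simp add: q_def)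
  have bP: "bounded_borel M P" unfolding P_def using f by (intro bounded_borel_prod) auto
  have bgq: "bounded_borel (M \<Otimes>\<^sub>M M) (\<lambda>p. g p * q (snd p))"
    by (intro bounded_borel_mult bounded bounded_snd bq)
  have bQ: "bounded_borel M Q"
    using bounded_borel_integral[OF bgq] by (simp add: Q_def)
  note [measurable] = bounded_borel_measurable[OF bQ]
  have b\<psi>: "bounded_borel M \<psi>"
    unfolding \<psi>_def by (rule bounded_vertex_mean) (use fin f in auto)
  have I0: "0 \<le> I"
    unfolding I_def \<psi>_def using nonneg by (auto intro!: Bochner_Integration.integral_nonneg)
  have \<psi>: "\<psi> s = (P s * q s) powr ((1 - \<theta>) / 2)" for s
  proof -
    have "1 / (2 * real (Suc e)) = (1 - \<theta>) / 2" by (simp add: \<theta>_def field_simps)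
    moreover have "(\<Prod>u\<in>insert w V. f u s) = P s * q s"
      using fin G(4) by (simp add: P_def q_def mult.commute)
    ultimately show ?thesis unfolding \<psi>_def vertex_mean_def card by (simp only:)
  qed
  have approx: "I ^ Suc e \<le> D' + \<epsilon> * D" if \<epsilon>: "0 < \<epsilon>" for \<epsilon>
  proof -
    let ?f = "f(v := \<lambda>s. f v s * (Q s + \<epsilon>))"
    define \<phi> where "\<phi> = vertex_mean V E ?f"
    define A where "A = (\<integral>(s, t). \<phi> s * g (s, t) * \<phi> t \<partial>(M \<Otimes>\<^sub>M M))"
    have bf: "bounded_borel M (?f u) \<and> (\<forall>t. 0 \<le> ?f u t)" if "u \<in> V" for u
      using that f bQ Q0 \<epsilon> G(3) by (auto intro!: bounded_borel_mult bounded_borel_add add_nonneg_nonneg)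
    have b\<phi>: "bounded_borel M \<phi>"
      unfolding \<phi>_def by (rule bounded_vertex_mean) (use fin bf in auto)
    have A0: "0 \<le> A"
      unfolding A_def \<phi>_def using nonneg by (auto intro!: Bochner_Integration.integral_nonneg)
    have Q\<epsilon>: "0 < Q s + \<epsilon>" for s using Q0[of s] \<epsilon> by simp
    have "(\<Prod>u\<in>V. ?f u s) = P s * (Q s + \<epsilon>)" for s
      unfolding P_def using fin G(3) by (simp add: prod.remove[of V v] mult_ac)
    then have \<phi>: "\<phi> s = (P s * (Q s + \<epsilon>)) powr (1 / (2 * real e))" for s
      unfolding \<phi>_def vertex_mean_def e_def by simp
    have "A ^ e \<le> hom_density M V E g ?f"
      using dom bf unfolding dominates_def A_def \<phi>_def e_def by blast
    also have "\<dots> = D' + \<epsilon> * D"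
      unfolding D'_def D_def using f bQ by (intro hom_density_add_weight G) auto
    finally have A: "A ^ e \<le> D' + \<epsilon> * D" .
    have IT: "I \<le> T powr \<theta>" if T: "A < T" for T
    proof -
      have T0: "0 < T" using T A0 by simp
      \<comment> \<open>the quotient that cancels \<open>Q\<close>; the majorant \<open>?U\<close> uses it with both orders of the variables\<close>
      let ?R = "\<lambda>(s, t). 1 / (Q s + \<epsilon>) * g (s, t) * q t"
      have bR: "bounded_borel (M \<Otimes>\<^sub>M M) ?R"
      proof (rule bounded_weighted[OF _ bq])
        show "bounded_borel M (\<lambda>s. 1 / (Q s + \<epsilon>))"
        proof (rule bounded_borelI)
          show "(\<lambda>s. 1 / (Q s + \<epsilon>)) \<in> borel_measurable M" by measurable
          show "\<bar>1 / (Q s + \<epsilon>)\<bar> \<le> 1 / \<epsilon>" for s using Q0[of s] \<epsilon> by (simp add: frac_le)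
        qed
      qed
      have bR': "bounded_borel (M \<Otimes>\<^sub>M M) (\<lambda>(s, t). ?R (t, s))"
      proof -
        have "bounded_borel (M \<Otimes>\<^sub>M M) (\<lambda>p. ?R (snd p, fst p))"
          by (intro bounded_borel_compose[OF bR]) measurable
        then show ?thesis by (simp add: case_prod_unfold)
      qed
      let ?A = "\<lambda>(s, t). \<phi> s * g (s, t) * \<phi> t"
      have bA: "bounded_borel (M \<Otimes>\<^sub>M M) ?A"
        using b\<phi> by (intro bounded_weighted)
      let ?U = "\<lambda>p. T powr \<theta> * (\<theta> / T * ?A p + (1 - \<theta>) / 2 * (?R p + (\<lambda>(s, t). ?R (t, s)) p))"
      have iA: "integrable (M \<Otimes>\<^sub>M M) ?A" and iR: "integrable (M \<Otimes>\<^sub>M M) ?R"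
        and iR': "integrable (M \<Otimes>\<^sub>M M) (\<lambda>(s, t). ?R (t, s))"
        by (intro square.P.integrable_bounded_borel bA bR bR')+
      have J: "(\<integral>p. ?R p \<partial>(M \<Otimes>\<^sub>M M)) \<le> 1"
      proof -
        have "(\<integral>p. ?R p \<partial>(M \<Otimes>\<^sub>M M)) = (\<integral>s. Q s / (Q s + \<epsilon>) \<partial>M)"
          by (subst integral_square[OF bR]) (simp add: Q_def mult.assoc)
        also have "\<dots> \<le> 1"
        proof (rule integral_le_const)
          have mQ\<epsilon>: "(\<lambda>s. Q s / (Q s + \<epsilon>)) \<in> borel_measurable M" by measurable
          have "\<bar>Q s / (Q s + \<epsilon>)\<bar> \<le> 1" for s using Q0[of s] \<epsilon> by simp
          then show "integrable M (\<lambda>s. Q s / (Q s + \<epsilon>))"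
            using mQ\<epsilon> by (intro integrable_bounded_borel bounded_borelI[where C = 1])
          show "AE s in M. Q s / (Q s + \<epsilon>) \<le> 1" using Q0 Q\<epsilon> \<epsilon> by (intro AE_I2) simp
        qed
        finally show ?thesis .
      qed
      have "I \<le> (\<integral>p. ?U p \<partial>(M \<Otimes>\<^sub>M M))"
        unfolding I_def
      proof (rule integral_mono)
        show "integrable (M \<Otimes>\<^sub>M M) (\<lambda>(s, t). \<psi> s * g (s, t) * \<psi> t)"
          using b\<psi> by (intro square.P.integrable_bounded_borel bounded_weighted)
        show "integrable (M \<Otimes>\<^sub>M M) ?U"
          using iA iR iR' by (intro integrable_mult_right Bochner_Integration.integrable_add)
        fix p :: "real \<times> real"
        obtain s t where p: "p = (s, t)" by (cases p)
        let ?Y = "sqrt ((q s / (Q t + \<epsilon>)) * (q t / (Q s + \<epsilon>)))"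
        have "\<psi> s * \<psi> t = (\<phi> s * \<phi> t) powr \<theta> * ?Y powr (1 - \<theta>)"
        proof -
          have "1 - \<theta> = 1 / (real e + 1)" by (simp add: \<theta>_def field_simps)
          then have r: "1 / (2 * real e) * \<theta> = (1 - \<theta>) / 2" using e by (simp add: \<theta>_def)
          have "(\<phi> s * \<phi> t) powr \<theta> = ((P s * (Q s + \<epsilon>)) * (P t * (Q t + \<epsilon>))) powr ((1 - \<theta>) / 2)"
            unfolding \<phi> r[symmetric] using P0 Q\<epsilon> by (simp add: powr_powr powr_mult less_imp_le)
          moreover have "?Y powr (1 - \<theta>) = ((q s / (Q t + \<epsilon>)) * (q t / (Q s + \<epsilon>))) powr ((1 - \<theta>) / 2)"
            using q0 Q\<epsilon> by (simp add: powr_powr less_imp_le flip: powr_half_sqrt)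
          ultimately have "(\<phi> s * \<phi> t) powr \<theta> * ?Y powr (1 - \<theta>) =
              (((P s * (Q s + \<epsilon>)) * (P t * (Q t + \<epsilon>))) *
                ((q s / (Q t + \<epsilon>)) * (q t / (Q s + \<epsilon>)))) powr ((1 - \<theta>) / 2)"
            by (simp only: powr_mult)
          also have "((P s * (Q s + \<epsilon>)) * (P t * (Q t + \<epsilon>))) *
                ((q s / (Q t + \<epsilon>)) * (q t / (Q s + \<epsilon>))) = (P s * q s) * (P t * q t)"
            using Q\<epsilon>[of s] Q\<epsilon>[of t] by simp
          finally show ?thesis unfolding \<psi> by (simp only: powr_mult)
        qed
        also have "\<dots> \<le> T powr \<theta> * (\<theta> * (\<phi> s * \<phi> t / T) + (1 - \<theta>) * ?Y)"
          using T0 \<theta> q0 Q\<epsilon>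
          by (intro powr_AM_GM_threshold) (auto simp: \<phi>_def less_imp_le)
        also have "\<dots> \<le> T powr \<theta> *
            (\<theta> * (\<phi> s * \<phi> t / T) + (1 - \<theta>) * ((q s / (Q t + \<epsilon>) + q t / (Q s + \<epsilon>)) / 2))"
          using \<theta> q0 Q\<epsilon>
          by (intro mult_left_mono add_left_mono arith_geo_mean_sqrt) (auto simp: less_imp_le)
        finally have "g (s, t) * (\<psi> s * \<psi> t) \<le> g (s, t) * \<dots>"
          using nonneg by (rule mult_left_mono)
        also have "\<dots> = ?U p"
          by (simp add: p g_swap[of t s] algebra_simps add_divide_distrib)
        finally show "(\<lambda>(s, t). \<psi> s * g (s, t) * \<psi> t) p \<le> ?U p"
          by (simp add: p mult_ac)
      qed
      also have "\<dots> = T powr \<theta> * (\<theta> / T * A + (1 - \<theta>) / 2 *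
          ((\<integral>p. ?R p \<partial>(M \<Otimes>\<^sub>M M)) + (\<integral>(s, t). ?R (t, s) \<partial>(M \<Otimes>\<^sub>M M))))"
      proof -
        have "(\<integral>p. ?U p \<partial>(M \<Otimes>\<^sub>M M)) = T powr \<theta> * (\<integral>p. \<theta> / T * ?A p + (1 - \<theta>) / 2 * (?R p + (\<lambda>(s, t). ?R (t, s)) p) \<partial>(M \<Otimes>\<^sub>M M))"
          by (rule integral_mult_right_zero)
        also have "(\<integral>p. \<theta> / T * ?A p + (1 - \<theta>) / 2 * (?R p + (\<lambda>(s, t). ?R (t, s)) p) \<partial>(M \<Otimes>\<^sub>M M))
          = (\<integral>p. \<theta> / T * ?A p \<partial>(M \<Otimes>\<^sub>M M)) + (\<integral>p. (1 - \<theta>) / 2 * (?R p + (\<lambda>(s, t). ?R (t, s)) p) \<partial>(M \<Otimes>\<^sub>M M))"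
          using iA iR iR' by (intro Bochner_Integration.integral_add integrable_mult_right Bochner_Integration.integrable_add)
        also have "(\<integral>p. \<theta> / T * ?A p \<partial>(M \<Otimes>\<^sub>M M)) = \<theta> / T * A"
          unfolding A_def by (rule integral_mult_right_zero)
        also have "(\<integral>p. (1 - \<theta>) / 2 * (?R p + (\<lambda>(s, t). ?R (t, s)) p) \<partial>(M \<Otimes>\<^sub>M M))
          = (1 - \<theta>) / 2 * (\<integral>p. ?R p + (\<lambda>(s, t). ?R (t, s)) p \<partial>(M \<Otimes>\<^sub>M M))"
          by (rule integral_mult_right_zero)
        also have "(\<integral>p. ?R p + (\<lambda>(s, t). ?R (t, s)) p \<partial>(M \<Otimes>\<^sub>M M))
          = (\<integral>p. ?R p \<partial>(M \<Otimes>\<^sub>M M)) + (\<integral>p. (\<lambda>(s, t). ?R (t, s)) p \<partial>(M \<Otimes>\<^sub>M M))"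
          by (rule Bochner_Integration.integral_add[OF iR iR'])
        finally show ?thesis by simp
      qed
      also have "\<dots> \<le> T powr \<theta> * (\<theta> * 1 + (1 - \<theta>) / 2 * (1 + 1))"
      proof -
        have "\<theta> / T * A \<le> \<theta> * 1" using \<theta> T T0 by (simp add: field_simps)
        then show ?thesis
          unfolding integral_square_swap[OF bR] using J \<theta>
          by (intro mult_left_mono add_mono) auto
      qed
      also have "\<theta> * 1 + (1 - \<theta>) / 2 * (1 + 1) = 1" by (simp add: field_simps)
      finally show ?thesis by simp
    qed
    \<comment> \<open>the bound \<open>I \<le> T powr \<theta>\<close>, cleared of the exponent; let \<open>T\<close> tend to \<open>A\<close>\<close>
    have pow: "I ^ Suc e \<le> T ^ e" if T: "A < T" for T
    proof -
      have T0: "0 < T" using T A0 by simp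
      have "I ^ Suc e \<le> (T powr \<theta>) ^ Suc e"
        using IT[OF T] I0 by (rule power_mono)
      also have "\<dots> = T powr (\<theta> * real (Suc e))"
        using T0 by (simp add: powr_powr flip: powr_realpow del: power_Suc of_nat_Suc)
      also have "\<theta> * real (Suc e) = real e" by (simp add: \<theta>_def field_simps)
      also have "T powr real e = T ^ e" using T0 by (rule powr_realpow)
      finally show ?thesis .
    qed
    have "I ^ Suc e \<le> A ^ e"
    proof (rule real_le_of_right_limit[where h = "\<lambda>T. T ^ e"])
      show "isCont (\<lambda>T. T ^ e) A" by (intro continuous_intros)
    qed (rule pow)
    with A show ?thesis by linarith
  qed
  have "I ^ Suc e \<le> D' + 0 * D"
  proof (rule real_le_of_right_limit[where h = "\<lambda>\<epsilon>. D' + \<epsilon> * D"])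
    show "isCont (\<lambda>\<epsilon>. D' + \<epsilon> * D) 0" by (intro continuous_intros)
  qed (rule approx)
  moreover have "hom_density M (insert w V) (insert {v, w} E) g f = D'"
    unfolding D'_def Q_def q_def using f by (intro hom_density_insert_leaf sym bounded G) auto
  ultimately show "(\<integral>(s, t). vertex_mean (insert w V) (insert {v, w} E) f s * g (s, t) *
        vertex_mean (insert w V) (insert {v, w} E) f t \<partial>(M \<Otimes>\<^sub>M M)) ^ card (insert {v, w} E)
      \<le> hom_density M (insert w V) (insert {v, w} E) g f"
    unfolding card I_def \<psi>_def by simp
qed

end

definition path_edges :: "nat \<Rightarrow> nat set set" where
  "path_edges n = (\<lambda>i. {i, Suc i}) ` {..<n}"

lemma simple_graph_path: "simple_graph {..n} (path_edges n)"
  by (auto simp: simple_graph_def path_edges_def)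

lemma (in nonneg_kernel) dominates_path:
  "dominates M g {..Suc n} (path_edges (Suc n))"
proof (induction n)
  case 0
  have "{..Suc 0} = {0, Suc 0}" "path_edges (Suc 0) = {{0, Suc 0}}"
    by (auto simp: path_edges_def)
  then show ?case using dominates_edge[of 0 "Suc 0"] by simp
next
  case (Suc n)
  have "path_edges (Suc (Suc n)) = insert {Suc n, Suc (Suc n)} (path_edges (Suc n))"
    by (simp add: path_edges_def lessThan_Suc)
  then show ?case
    using dominates_add_leaf[OF simple_graph_path _ _ _ Suc, of "Suc n" "Suc (Suc n)"]
    by (simp add: path_edges_def lessThan_Suc atMost_Suc)
qed

section \<open>Composition of kernels and walks\<close>

context real_prob_space
begin

text \<open>
  Kernels behave like matrices with rows and columns indexed by the space: \<open>kcomp\<close> is their product.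
\<close>

definition kcomp :: "(real \<times> real \<Rightarrow> real) \<Rightarrow> (real \<times> real \<Rightarrow> real) \<Rightarrow> real \<times> real \<Rightarrow> real" where
  "kcomp K L = (\<lambda>(s, t). \<integral>z. K (s, z) * L (z, t) \<partial>M)"

text \<open>
  In the absence of an identity kernel the powers start with the first one: \<open>kpow A n\<close> stands
  for the power of \<open>A\<close> with exponent \<open>n + 1\<close>.
\<close>

primrec kpow :: "(real \<times> real \<Rightarrow> real) \<Rightarrow> nat \<Rightarrow> real \<times> real \<Rightarrow> real" where
  "kpow A 0 = A"
| "kpow A (Suc n) = kcomp (kpow A n) A"

text \<open>
  The product of \<open>C\<close> and its transpose, that is, the Gram kernel of the rows of \<open>C\<close>.
\<close>

definition gram :: "(real \<times> real \<Rightarrow> real) \<Rightarrow> real \<times> real \<Rightarrow> real" where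
  "gram C = kcomp C (\<lambda>(s, t). C (t, s))"

lemma gram_eq: "gram C (s, t) = (\<integral>z. C (s, z) * C (t, z) \<partial>M)"
  by (simp add: gram_def kcomp_def)

lemma gram_swap: "gram C (s, t) = gram C (t, s)"
  by (simp add: gram_eq mult.commute)

lemma bounded_kcomp:
  assumes "bounded_borel (M \<Otimes>\<^sub>M M) K" "bounded_borel (M \<Otimes>\<^sub>M M) L"
  shows "bounded_borel (M \<Otimes>\<^sub>M M) (kcomp K L)"
proof -
  have "bounded_borel ((M \<Otimes>\<^sub>M M) \<Otimes>\<^sub>M M) (\<lambda>q. K (fst (fst q), snd q) * L (snd q, snd (fst q)))"
    by (intro bounded_borel_mult bounded_borel_compose[OF assms(1)] bounded_borel_compose[OF assms(2)])
      measurable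
  from bounded_borel_integral[OF this] show ?thesis
    by (simp add: kcomp_def case_prod_unfold)
qed

lemma bounded_swap:
  assumes "bounded_borel (M \<Otimes>\<^sub>M M) K"
  shows "bounded_borel (M \<Otimes>\<^sub>M M) (\<lambda>(s, t). K (t, s))"
proof -
  have "bounded_borel (M \<Otimes>\<^sub>M M) (\<lambda>p. K (snd p, fst p))"
    by (intro bounded_borel_compose[OF assms]) measurable
  then show ?thesis by (simp add: case_prod_unfold)
qed

lemma bounded_gram: "bounded_borel (M \<Otimes>\<^sub>M M) C \<Longrightarrow> bounded_borel (M \<Otimes>\<^sub>M M) (gram C)"
  unfolding gram_def by (intro bounded_kcomp bounded_swap)

lemma bounded_kpow: "bounded_borel (M \<Otimes>\<^sub>M M) A \<Longrightarrow> bounded_borel (M \<Otimes>\<^sub>M M) (kpow A n)"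
  by (induction n) (auto intro: bounded_kcomp)

lemma bounded_row:
  "bounded_borel (M \<Otimes>\<^sub>M M) K \<Longrightarrow> s \<in> space M \<Longrightarrow> bounded_borel M (\<lambda>t. K (s, t))"
  by (erule bounded_borel_compose) measurable

text \<open>
  Fubini's theorem. The point must lie in the space, since sections of a measurable kernel at other
  points need not be measurable.
\<close>

lemma kcomp_assoc:
  assumes K: "bounded_borel (M \<Otimes>\<^sub>M M) K" and L: "bounded_borel (M \<Otimes>\<^sub>M M) L"
    and N: "bounded_borel (M \<Otimes>\<^sub>M M) N" and p: "p \<in> space (M \<Otimes>\<^sub>M M)"
  shows "kcomp (kcomp K L) N p = kcomp K (kcomp L N) p"
proof -
  obtain s t where p: "p = (s, t)" and st: "s \<in> space M" "t \<in> space M"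
    using p by (auto simp: space_pair_measure)
  let ?f = "\<lambda>y z. K (s, y) * L (y, z) * N (z, t)"
  have "bounded_borel (M \<Otimes>\<^sub>M M) (\<lambda>p. K (s, fst p) * L p * N (snd p, t))"
    using st by (intro bounded_borel_mult bounded_borel_compose[OF K] bounded_borel_compose[OF N] L) measurable
  then have "integrable (M \<Otimes>\<^sub>M M) (case_prod ?f)"
    by (intro square.P.integrable_bounded_borel) (simp add: case_prod_unfold)
  then have "(\<integral>z. (\<integral>y. ?f y z \<partial>M) \<partial>M) = (\<integral>y. (\<integral>z. ?f y z \<partial>M) \<partial>M)"
    by (rule square.Fubini_integral)
  moreover have "kcomp (kcomp K L) N p = (\<integral>z. (\<integral>y. ?f y z \<partial>M) \<partial>M)"
    by (simp add: p kcomp_def)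
  moreover have "kcomp K (kcomp L N) p = (\<integral>y. (\<integral>z. ?f y z \<partial>M) \<partial>M)"
    by (simp add: p kcomp_def mult.assoc)
  ultimately show ?thesis by simp
qed

lemma kcomp_cong:
  assumes "\<And>p. p \<in> space (M \<Otimes>\<^sub>M M) \<Longrightarrow> K p = K' p" "\<And>p. p \<in> space (M \<Otimes>\<^sub>M M) \<Longrightarrow> L p = L' p"
    and "p \<in> space (M \<Otimes>\<^sub>M M)"
  shows "kcomp K L p = kcomp K' L' p"
  using assms unfolding kcomp_def
  by (auto simp: space_pair_measure intro!: Bochner_Integration.integral_cong)

lemma kcomp_kpow:
  assumes "bounded_borel (M \<Otimes>\<^sub>M M) A" "p \<in> space (M \<Otimes>\<^sub>M M)"
  shows "kcomp A (kpow A n) p = kpow A (Suc n) p"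
  using assms(2)
proof (induction n arbitrary: p)
  case (Suc n)
  have "kcomp A (kpow A (Suc n)) p = kcomp (kcomp A (kpow A n)) A p"
    using assms(1) Suc.prems by (simp add: kcomp_assoc bounded_kpow)
  also have "\<dots> = kcomp (kpow A (Suc n)) A p"
    by (rule kcomp_cong) (use Suc in auto)
  finally show ?case by simp
qed simp

text \<open>
  For symmetric \<open>A\<close>, if a power of \<open>A\<close> is \<open>C C\<^sup>T\<close>, then the power with the exponent raised by two is
  \<open>A C C\<^sup>T A = (A C) (A C)\<^sup>T\<close>. Odd exponents start from \<open>A = B B\<^sup>T\<close> and even ones from \<open>A A = A A\<^sup>T\<close>.
\<close>

lemma kpow_gram_is_gram:
  assumes B: "bounded_borel (M \<Otimes>\<^sub>M M) B"
  shows "\<exists>C. bounded_borel (M \<Otimes>\<^sub>M M) C \<and> (\<forall>p \<in> space (M \<Otimes>\<^sub>M M). kpow (gram B) n p = gram C p)"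
proof (induction n rule: nat_less_induct)
  case (1 n)
  let ?A = "gram B"
  have A: "bounded_borel (M \<Otimes>\<^sub>M M) ?A" using B by (rule bounded_gram)
  consider "n = 0" | "n = 1" | m where "n = Suc (Suc m)"
    by (metis One_nat_def not0_implies_Suc)
  then show ?case
  proof cases
    case 1
    then show ?thesis using B by auto
  next
    case 2
    have "(\<lambda>(s, t). ?A (t, s)) = ?A" by (auto simp: gram_swap)
    then have "gram ?A = kcomp ?A ?A" by (simp add: gram_def[of ?A])
    then show ?thesis using 2 A by auto
  next
    case 3
    then obtain C where C: "bounded_borel (M \<Otimes>\<^sub>M M) C"
      and eq: "\<And>p. p \<in> space (M \<Otimes>\<^sub>M M) \<Longrightarrow> kpow ?A m p = gram C p"
      using 1 by (metis lessI less_SucI)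
    let ?C' = "\<lambda>(s, t). C (t, s)"
    have C': "bounded_borel (M \<Otimes>\<^sub>M M) ?C'" using C by (rule bounded_swap)
    have "kpow ?A n p = gram (kcomp ?A C) p" if p: "p \<in> space (M \<Otimes>\<^sub>M M)" for p
    proof -
      have "kpow ?A n p = kcomp ?A (kpow ?A (Suc m)) p"
        using kcomp_kpow[OF A p, of "Suc m"] by (simp add: 3)
      also have "\<dots> = kcomp ?A (kcomp (gram C) ?A) p"
        using p by (intro kcomp_cong) (auto intro!: kcomp_cong simp: eq)
      also have "\<dots> = kcomp ?A (kcomp C (kcomp ?C' ?A)) p"
        using p unfolding gram_def[of C] by (intro kcomp_cong kcomp_assoc C C' A) auto
      also have "\<dots> = kcomp (kcomp ?A C) (kcomp ?C' ?A) p"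
        using p by (intro kcomp_assoc[symmetric] bounded_kcomp C C' A)
      also have "kcomp ?C' ?A = (\<lambda>(s, t). kcomp ?A C (t, s))"
        by (simp add: kcomp_def fun_eq_iff gram_swap mult.commute)
      finally show ?thesis by (simp add: gram_def[of "kcomp _ C"])
    qed
    then show ?thesis using bounded_kcomp[OF A C] by blast
  qed
qed

text \<open>
  The entry of a Gram kernel at \<open>(s, t)\<close> is at most the arithmetic mean of its diagonal entries at \<open>s\<close> and
  \<open>t\<close>. The right-hand side is the trace.
\<close>

lemma trace_gram_ge:
  assumes C: "bounded_borel (M \<Otimes>\<^sub>M M) C"
  shows "(\<integral>p. gram C p \<partial>(M \<Otimes>\<^sub>M M)) \<le> (\<integral>s. gram C (s, s) \<partial>M)"
proof -
  let ?d = "\<lambda>s. gram C (s, s)"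
  have G: "bounded_borel (M \<Otimes>\<^sub>M M) (gram C)" using C by (rule bounded_gram)
  have d: "bounded_borel M ?d" by (intro bounded_borel_compose[OF G]) measurable
  have d1: "bounded_borel (M \<Otimes>\<^sub>M M) (\<lambda>p. ?d (fst p))" by (intro bounded_borel_compose[OF d]) measurable
  have d2: "bounded_borel (M \<Otimes>\<^sub>M M) (\<lambda>p. ?d (snd p))" by (intro bounded_borel_compose[OF d]) measurable
  have "(\<integral>p. gram C p \<partial>(M \<Otimes>\<^sub>M M)) \<le> (\<integral>p. ?d (fst p) / 2 + ?d (snd p) / 2 \<partial>(M \<Otimes>\<^sub>M M))"
  proof (rule integral_mono_AE)
    show "AE p in M \<Otimes>\<^sub>M M. gram C p \<le> ?d (fst p) / 2 + ?d (snd p) / 2"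
    proof (rule AE_I2)
      fix p assume "p \<in> space (M \<Otimes>\<^sub>M M)"
      then obtain s t where p: "p = (s, t)" "s \<in> space M" "t \<in> space M"
        by (auto simp: space_pair_measure)
      have int: "integrable M (\<lambda>z. C (u, z) * C (v, z))" if "u \<in> space M" "v \<in> space M" for u v
        using that by (intro integrable_bounded_borel bounded_borel_mult bounded_row C)
      have "gram C p \<le> (\<integral>z. C (s, z) * C (s, z) / 2 + C (t, z) * C (t, z) / 2 \<partial>M)"
        unfolding p(1) gram_eq
      proof (rule integral_mono)
        fix z
        have "0 \<le> (C (s, z) - C (t, z))\<^sup>2" by simp
        then show "C (s, z) * C (t, z) \<le> C (s, z) * C (s, z) / 2 + C (t, z) * C (t, z) / 2"
          by (simp add: power2_eq_square algebra_simps)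
      qed (use p int in auto)
      also have "\<dots> = ?d s / 2 + ?d t / 2"
        using p int by (simp add: gram_eq)
      finally show "gram C p \<le> ?d (fst p) / 2 + ?d (snd p) / 2" by (simp add: p)
    qed
    show "integrable (M \<Otimes>\<^sub>M M) (gram C)" using G by (rule square.P.integrable_bounded_borel)
    show "integrable (M \<Otimes>\<^sub>M M) (\<lambda>p. ?d (fst p) / 2 + ?d (snd p) / 2)"
      using d1 d2
      by (intro Bochner_Integration.integrable_add integrable_divide square.P.integrable_bounded_borel)
  qed
  also have "\<dots> = (\<integral>p. ?d (fst p) \<partial>(M \<Otimes>\<^sub>M M)) / 2 + (\<integral>p. ?d (snd p) \<partial>(M \<Otimes>\<^sub>M M)) / 2"
    using d1 d2 by (simp add: square.P.integrable_bounded_borel)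
  also have "\<dots> = (\<integral>s. ?d s \<partial>M)"
    by (simp add: integral_square[OF d1] integral_square[OF d2] prob_space)
  finally show ?thesis .
qed

lemma bounded_walk:
  assumes A: "bounded_borel (M \<Otimes>\<^sub>M M) A" and F: "bounded_borel (M \<Otimes>\<^sub>M M) F" and "m \<le> n"
  shows "bounded_borel (cube {..n}) (\<lambda>x. F (x 0, x m) * (\<Prod>i<m. A (x i, x (Suc i))))"
  using assms(3)
  by (intro bounded_borel_mult bounded_borel_prod bounded_borel_compose[OF A] bounded_borel_compose[OF F])
    (auto intro!: measurable_Pair measurable_component_singleton)

lemma bounded_kcomp_transpose:
  assumes K: "bounded_borel (M \<Otimes>\<^sub>M M) K" and L: "bounded_borel (M \<Otimes>\<^sub>M M) L"
  shows "bounded_borel (M \<Otimes>\<^sub>M M) (\<lambda>(s, u). \<integral>y. K (s, y) * L (u, y) \<partial>M)"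
  using bounded_kcomp[OF K bounded_swap[OF L]] by (simp add: kcomp_def)

text \<open>
  The last vertex of the walk occurs in \<open>F\<close> and in the last factor only. Integrating it out replaces \<open>F\<close>
  by the product of \<open>F\<close> and the transpose of \<open>A\<close>, and shortens the walk by one step. The function \<open>F\<close> of the
  two ends allows for paths (\<open>F = 1\<close>) as well as for cycles (\<open>F (s, t) = A (t, s)\<close>).
\<close>

lemma integral_walk:
  assumes A: "bounded_borel (M \<Otimes>\<^sub>M M) A" and F: "bounded_borel (M \<Otimes>\<^sub>M M) F"
  shows "(\<integral>x. F (x 0, x (Suc n)) * (\<Prod>i<Suc n. A (x i, x (Suc i))) \<partial>cube {..Suc n})
    = (\<integral>p. F p * kpow A n p \<partial>(M \<Otimes>\<^sub>M M))"
  using F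
proof (induction n arbitrary: F)
  case (0 F)
  have FA: "bounded_borel (M \<Otimes>\<^sub>M M) (\<lambda>p. F p * A p)"
    using 0 A by (rule bounded_borel_mult)
  have "bounded_borel M (\<lambda>s. \<integral>y. F (s, y) * A (s, y) \<partial>M)"
    using bounded_borel_integral[OF FA] by simp
  note single = cube.product_integral_singleton[OF bounded_borel_measurable[OF this], of "0 :: nat"]
  have "(\<integral>x. F (x 0, x (Suc 0)) * (\<Prod>i<Suc 0. A (x i, x (Suc i))) \<partial>cube {..Suc 0})
      = (\<integral>x. F (x 0, x (Suc 0)) * A (x 0, x (Suc 0)) \<partial>cube (insert (Suc 0) {0}))"
    by (simp add: atMost_Suc insert_commute)
  also have "\<dots> = (\<integral>x. (\<integral>y. F ((x(Suc 0 := y)) 0, (x(Suc 0 := y)) (Suc 0)) *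
      A ((x(Suc 0 := y)) 0, (x(Suc 0 := y)) (Suc 0)) \<partial>M) \<partial>cube {0})"
    using bounded_walk[OF A 0, of "Suc 0" "Suc 0"]
    by (intro cube.product_integral_insert integrable_cube) (auto simp: atMost_Suc insert_commute)
  also have "\<dots> = (\<integral>x. (\<integral>y. F (x 0, y) * A (x 0, y) \<partial>M) \<partial>cube {0::nat})" by simp
  also have "\<dots> = (\<integral>s. (\<integral>y. F (s, y) * A (s, y) \<partial>M) \<partial>M)" by (rule single)
  finally show ?case by (simp add: integral_square[OF FA])
next
  case (Suc n F)
  let ?G = "\<lambda>(s, u). \<integral>y. F (s, y) * A (u, y) \<partial>M"
  let ?n = "Suc (Suc n)"
  let ?W = "\<lambda>x. \<Prod>i<Suc n. A (x i, x (Suc i))"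
  have G: "bounded_borel (M \<Otimes>\<^sub>M M) ?G" using Suc.prems A by (rule bounded_kcomp_transpose)
  have P: "bounded_borel (M \<Otimes>\<^sub>M M) (kpow A n)" using A by (rule bounded_kpow)
  have "(\<integral>x. F (x 0, x ?n) * (\<Prod>i<?n. A (x i, x (Suc i))) \<partial>cube {..?n})
      = (\<integral>x. F (x 0, x ?n) * (\<Prod>i<?n. A (x i, x (Suc i))) \<partial>cube (insert ?n {..Suc n}))"
    by (simp add: atMost_Suc)
  also have "\<dots> = (\<integral>x. (\<integral>y. F ((x(?n := y)) 0, (x(?n := y)) ?n) *
      (\<Prod>i<?n. A ((x(?n := y)) i, (x(?n := y)) (Suc i))) \<partial>M) \<partial>cube {..Suc n})"
    using bounded_walk[OF A Suc.prems, of ?n ?n]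
    by (intro cube.product_integral_insert integrable_cube) (auto simp: atMost_Suc)
  also have "\<dots> = (\<integral>x. ?G (x 0, x (Suc n)) * ?W x \<partial>cube {..Suc n})"
  proof (intro Bochner_Integration.integral_cong refl)
    fix x :: "nat \<Rightarrow> real"
    have "(\<Prod>i<?n. A ((x(?n := y)) i, (x(?n := y)) (Suc i))) = ?W x * A (x (Suc n), y)" for y
      unfolding prod.lessThan_Suc[of _ "Suc n"]
      by (intro arg_cong2[where f = "(*)"] prod.cong) auto
    then have "(\<integral>y. F ((x(?n := y)) 0, (x(?n := y)) ?n) *
        (\<Prod>i<?n. A ((x(?n := y)) i, (x(?n := y)) (Suc i))) \<partial>M)
      = (\<integral>y. F (x 0, y) * A (x (Suc n), y) * ?W x \<partial>M)"
      by (simp add: mult_ac)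
    then show "(\<integral>y. F ((x(?n := y)) 0, (x(?n := y)) ?n) *
        (\<Prod>i<?n. A ((x(?n := y)) i, (x(?n := y)) (Suc i))) \<partial>M) = ?G (x 0, x (Suc n)) * ?W x"
      by (simp del: prod.lessThan_Suc)
  qed
  also have "\<dots> = (\<integral>p. ?G p * kpow A n p \<partial>(M \<Otimes>\<^sub>M M))" by (rule Suc.IH[OF G])
  also have "\<dots> = (\<integral>s. (\<integral>u. ?G (s, u) * kpow A n (s, u) \<partial>M) \<partial>M)"
    by (intro integral_square bounded_borel_mult G P)
  also have "\<dots> = (\<integral>s. (\<integral>y. F (s, y) * kpow A (Suc n) (s, y) \<partial>M) \<partial>M)"
  proof (rule Bochner_Integration.integral_cong[OF refl])
    fix s assume s: "s \<in> space M"
    let ?f = "\<lambda>y u. F (s, y) * A (u, y) * kpow A n (s, u)"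
    have "bounded_borel (M \<Otimes>\<^sub>M M) (\<lambda>p. F (s, fst p) * A (snd p, fst p) * kpow A n (s, snd p))"
      using s
      by (intro bounded_borel_mult bounded_borel_compose[OF Suc.prems] bounded_borel_compose[OF A]
          bounded_borel_compose[OF P]) measurable
    then have "integrable (M \<Otimes>\<^sub>M M) (case_prod ?f)"
      by (intro square.P.integrable_bounded_borel) (simp add: case_prod_unfold)
    then have swap: "(\<integral>u. (\<integral>y. ?f y u \<partial>M) \<partial>M) = (\<integral>y. (\<integral>u. ?f y u \<partial>M) \<partial>M)"
      by (rule square.Fubini_integral)
    have "?f y u = F (s, y) * (kpow A n (s, u) * A (u, y))" for y u
      by simp
    then have "(\<integral>y. (\<integral>u. ?f y u \<partial>M) \<partial>M) = (\<integral>y. F (s, y) * kpow A (Suc n) (s, y) \<partial>M)"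
      by (simp only: kpow.simps kcomp_def prod.case integral_mult_right_zero)
    with swap show "(\<integral>u. ?G (s, u) * kpow A n (s, u) \<partial>M) = (\<integral>y. F (s, y) * kpow A (Suc n) (s, y) \<partial>M)"
      by simp
  qed
  also have "\<dots> = (\<integral>p. F p * kpow A (Suc n) p \<partial>(M \<Otimes>\<^sub>M M))"
    by (intro integral_square[symmetric] bounded_borel_mult Suc.prems bounded_kpow A)
  finally show ?case .
qed

lemma AE_pair_swap:
  assumes "AE p in M \<Otimes>\<^sub>M M. Q p"
  shows "AE p in M \<Otimes>\<^sub>M M. Q (snd p, fst p)"
proof -
  have "AE p in distr (M \<Otimes>\<^sub>M M) (M \<Otimes>\<^sub>M M) (\<lambda>(x, y). (y, x)). Q p"
    unfolding square.distr_pair_swap[symmetric] by (rule assms)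
  then have "AE p in M \<Otimes>\<^sub>M M. Q (case p of (x, y) \<Rightarrow> (y, x))"
    by (rule AE_distrD[rotated]) measurable
  then show ?thesis by (simp add: case_prod_unfold)
qed

lemma AE_pair_fst:
  assumes "AE x in M. Q x"
  shows "AE p in M \<Otimes>\<^sub>M M. Q (fst p)"
proof -
  have "AE x in distr (M \<Otimes>\<^sub>M M) M fst. Q x"
    unfolding distr_pair_fst by (rule assms)
  then show ?thesis by (rule AE_distrD[rotated]) measurable
qed

text \<open>
  Any two different coordinates are independent. Hence a change of the kernel on a null set of the
  square does not change densities.
\<close>

lemma distr_cube_pair:
  assumes "u \<in> V" "v \<in> V" "u \<noteq> v" "finite V"
  shows "distr (cube V) (M \<Otimes>\<^sub>M M) (\<lambda>x. (x u, x v)) = M \<Otimes>\<^sub>M M"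
proof (rule pair_measure_eqI[symmetric])
  fix A B assume AB: "A \<in> sets M" "B \<in> sets M"
  let ?X = "\<lambda>w. if w = u then A else if w = v then B else space M"
  have X: "?X w \<in> sets M" for w using AB by auto
  have "(\<lambda>x. (x u, x v)) -` (A \<times> B) \<inter> space (cube V) = (\<Pi>\<^sub>E w\<in>V. ?X w)"
  proof (rule set_eqI)
    fix x
    have "(\<forall>w\<in>V. x w \<in> ?X w) \<longleftrightarrow> x u \<in> A \<and> x v \<in> B \<and> (\<forall>w\<in>V. x w \<in> space M)"
      using assms(1-3) sets.sets_into_space[OF AB(1)] sets.sets_into_space[OF AB(2)]
      by (smt (verit, best) subsetD)
    then show "x \<in> (\<lambda>x. (x u, x v)) -` (A \<times> B) \<inter> space (cube V) \<longleftrightarrow> x \<in> (\<Pi>\<^sub>E w\<in>V. ?X w)"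
      by (simp only: space_PiM PiE_iff vimage_eq mem_Times_iff fst_conv snd_conv Int_iff) blast
  qed
  then have "emeasure (distr (cube V) (M \<Otimes>\<^sub>M M) (\<lambda>x. (x u, x v))) (A \<times> B)
      = emeasure (cube V) (\<Pi>\<^sub>E w\<in>V. ?X w)"
    using assms AB by (subst emeasure_distr) auto
  also have "\<dots> = (\<Prod>w\<in>V. emeasure M (?X w))"
    using assms(4) X by (rule cube.emeasure_PiM)
  also have "\<dots> = (\<Prod>w\<in>{u, v}. emeasure M (?X w))"
    using assms by (intro prod.mono_neutral_right) (auto simp: emeasure_space_1)
  also have "\<dots> = emeasure M A * emeasure M B" using assms(3) by simp
  finally show "emeasure M A * emeasure M B =
      emeasure (distr (cube V) (M \<Otimes>\<^sub>M M) (\<lambda>x. (x u, x v))) (A \<times> B)" by simp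
qed (auto intro: sigma_finite_measure_axioms)

lemma AE_cube_pair:
  assumes V: "u \<in> V" "v \<in> V" "u \<noteq> v" "finite V" and AE: "AE p in M \<Otimes>\<^sub>M M. Q p"
  shows "AE x in cube V. Q (x u, x v)"
proof -
  have "AE p in distr (cube V) (M \<Otimes>\<^sub>M M) (\<lambda>x. (x u, x v)). Q p"
    unfolding distr_cube_pair[OF V] by (rule AE)
  then show ?thesis
    by (rule AE_distrD[rotated]) (use V in measurable)
qed


end

text \<open>
  Nonnegativity of \<open>g\<close> is assumed everywhere, but the Gram representation only almost everywhere; the
  kernel \<open>gram h\<close> may take negative values on a null set.
\<close>

locale psd_kernel = nonneg_kernel +
  fixes h :: "real \<times> real \<Rightarrow> real"
  assumes bounded_root: "bounded_borel (M \<Otimes>\<^sub>M M) h"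
    and root: "AE p in M \<Otimes>\<^sub>M M. g p = gram h p"

lemma Suc_mod_less: "i < n \<Longrightarrow> Suc i mod n = (if Suc i = n then 0 else Suc i)"
  by (auto simp: mod_Suc)

lemma inj_on_cycle_edge:
  assumes "3 \<le> n" shows "inj_on (\<lambda>i. {i, Suc i mod n}) {..<n}"
proof (rule inj_onI)
  fix i j assume ij: "i \<in> {..<n}" "j \<in> {..<n}" "{i, Suc i mod n} = {j, Suc j mod n}"
  show "i = j"
  proof (rule ccontr)
    assume "i \<noteq> j"
    then have "i = Suc j mod n" "j = Suc i mod n" using ij(3) by (auto simp: doubleton_eq_iff)
    then show False using ij(1,2) assms by (auto simp: Suc_mod_less split: if_splits)
  qed
qed

lemma simple_graph_cycle: "3 \<le> n \<Longrightarrow> simple_graph {..<n} (cycle_edges n)"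
  by (auto simp: simple_graph_def cycle_edges_def Suc_mod_less)

lemma card_cycle_edges: "3 \<le> n \<Longrightarrow> card (cycle_edges n) = n"
  by (simp add: cycle_edges_def card_image inj_on_cycle_edge)

lemma prod_path_edges:
  assumes "symmetric_kernel g"
  shows "(\<Prod>e\<in>path_edges n. edge_value g x e) = (\<Prod>i<n. g (x i, x (Suc i)))"
proof -
  have "inj_on (\<lambda>i. {i, Suc i}) {..<n}" by (auto simp: inj_on_def doubleton_eq_iff)
  then show ?thesis using assms by (simp add: path_edges_def prod.reindex edge_value_pair)
qed

lemma prod_cycle_edges:
  assumes "symmetric_kernel g" "3 \<le> Suc n"
  shows "(\<Prod>e\<in>cycle_edges (Suc n). edge_value g x e) = g (x n, x 0) * (\<Prod>i<n. g (x i, x (Suc i)))"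
proof -
  have "(\<Prod>e\<in>cycle_edges (Suc n). edge_value g x e) = (\<Prod>i<Suc n. g (x i, x (Suc i mod Suc n)))"
    unfolding cycle_edges_def
    using assms inj_on_cycle_edge[OF assms(2)] by (simp add: prod.reindex edge_value_pair del: prod.lessThan_Suc)
  also have "\<dots> = g (x n, x 0) * (\<Prod>i<n. g (x i, x (Suc i)))" by (simp add: mult.commute)
  finally show ?thesis .
qed

text \<open>
  Every vertex of a cycle is an end of two of its edges, so a weight can be split evenly between them.
\<close>

lemma prod_consecutive_cyclic:
  fixes a :: "nat \<Rightarrow> real"
  shows "a n * a 0 * (\<Prod>i<n. a i * a (Suc i)) = (\<Prod>i\<le>n. (a i)\<^sup>2)"
proof -
  have "a 0 * (\<Prod>i<n. a i * a (Suc i)) = a n * (\<Prod>i<n. (a i)\<^sup>2)"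
    by (induction n) (simp_all add: power2_eq_square mult_ac)
  then show ?thesis by (simp add: power2_eq_square lessThan_Suc_atMost[symmetric] mult_ac)
qed

context psd_kernel
begin

text \<open>
  With \<open>A (s, t) = sqrt (\<phi> s) * g (s, t) * sqrt (\<phi> t)\<close>, the density of the cycle is the trace of the \<open>n\<close>-th
  power of \<open>A\<close>, and the total integral of this power is the density of the path with \<open>n\<close> edges in the kernel
  \<open>A\<close> with all vertex weights \<open>1\<close>. The former is at least the latter since the power is a Gram kernel, and the
  path inequality applies to the latter. In between, \<open>A\<close> has to be replaced by the Gram kernel that it
  equals almost everywhere.
\<close>

lemma hom_density_cycle_const:
  assumes n: "3 \<le> n" and \<phi>: "bounded_borel M \<phi>" "\<And>t. 0 \<le> \<phi> t"
  shows "(\<integral>(s, t). sqrt (\<phi> s) * g (s, t) * sqrt (\<phi> t) \<partial>(M \<Otimes>\<^sub>M M)) ^ n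
    \<le> hom_density M {..<n} (cycle_edges n) g (\<lambda>_. \<phi>)"
proof -
  define m where "m = n - 2"
  have m: "n = Suc (Suc m)" using n by (simp add: m_def)
  define r where "r = (\<lambda>s. sqrt (\<phi> s))"
  define A where "A = (\<lambda>(s, t). r s * g (s, t) * r t)"
  define B where "B = (\<lambda>(s, z). r s * h (s, z))"
  have r: "bounded_borel M r"
    using bounded_borel_powr[OF \<phi>(1), of "1 / 2"] \<phi>(2) by (simp add: r_def powr_half_sqrt)
  have A: "bounded_borel (M \<Otimes>\<^sub>M M) A" unfolding A_def using r by (intro bounded_weighted)
  have "bounded_borel (M \<Otimes>\<^sub>M M) (\<lambda>p. r (fst p) * h p)"
    by (intro bounded_borel_mult bounded_fst r bounded_root)
  then have B: "bounded_borel (M \<Otimes>\<^sub>M M) B" by (simp add: B_def case_prod_unfold)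
  interpret A: nonneg_kernel M A
  proof unfold_locales
    show "symmetric_kernel A" by (simp add: symmetric_kernel_def A_def g_swap mult_ac)
    show "bounded_borel (M \<Otimes>\<^sub>M M) A" by (rule A)
    show "0 \<le> A p" for p using nonneg \<phi>(2) by (auto simp: A_def r_def split: prod.split)
  qed
  have gB: "gram B (s, t) = r s * gram h (s, t) * r t" for s t
    by (simp add: gram_eq B_def mult.assoc mult.left_commute)
  have AE: "AE p in M \<Otimes>\<^sub>M M. A p = gram B p"
    using root by eventually_elim (auto simp: A_def gB split: prod.split)
  note G = bounded_gram[OF B]
  have AE_path: "AE x in cube {..k}. (\<Prod>i<k. A (x i, x (Suc i))) = (\<Prod>i<k. gram B (x i, x (Suc i)))"
    for k :: nat
  proof -
    have "AE x in cube {..k}. \<forall>i\<in>{..<k}. A (x i, x (Suc i)) = gram B (x i, x (Suc i))"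
      by (intro AE_finite_allI AE_cube_pair[OF _ _ _ _ AE]) auto
    then show ?thesis by eventually_elim (auto intro: prod.cong)
  qed
  have AE_close: "AE x in cube {..Suc m}. A (x (Suc m), x 0) = gram B (x (Suc m), x 0)"
    by (intro AE_cube_pair[OF _ _ _ _ AE]) auto
  have meas_path: "(\<lambda>x. \<Prod>i<k. K (x i, x (Suc i))) \<in> borel_measurable (cube {..k})"
    if "bounded_borel (M \<Otimes>\<^sub>M M) K" for K and k :: nat
    using bounded_walk[OF that bounded_borel_const[of _ 1], of k k] by (simp add: bounded_borel_measurable)
  have meas_cycle: "(\<lambda>x. K (x (Suc m), x 0) * (\<Prod>i<Suc m. K (x i, x (Suc i)))) \<in> borel_measurable (cube {..Suc m})"
    if K: "bounded_borel (M \<Otimes>\<^sub>M M) K" for K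
    using bounded_walk[OF K bounded_swap[OF K], of "Suc m" "Suc m"]
    by (simp add: bounded_borel_measurable del: prod.lessThan_Suc)
  \<comment> \<open>the density of the cycle is the trace of \<open>kpow (gram B) (Suc m)\<close>, the \<open>n\<close>-th power\<close>
  have "hom_density M {..<n} (cycle_edges n) g (\<lambda>_. \<phi>)
      = (\<integral>x. A (x (Suc m), x 0) * (\<Prod>i<Suc m. A (x i, x (Suc i))) \<partial>cube {..Suc m})"
  proof -
    have "(\<Prod>e\<in>cycle_edges n. edge_value g x e) * (\<Prod>v\<in>{..<n}. \<phi> (x v))
        = A (x (Suc m), x 0) * (\<Prod>i<Suc m. A (x i, x (Suc i)))" for x
    proof -
      have "(\<Prod>v\<in>{..<n}. \<phi> (x v)) = (\<Prod>v\<le>Suc m. (r (x v))\<^sup>2)"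
        using \<phi>(2) by (simp add: m r_def lessThan_Suc_atMost)
      also have "\<dots> = r (x (Suc m)) * r (x 0) * (\<Prod>i<Suc m. r (x i) * r (x (Suc i)))"
        by (rule prod_consecutive_cyclic[symmetric])
      finally have "(\<Prod>v\<in>{..<n}. \<phi> (x v)) = \<dots>" .
      moreover have "(\<Prod>e\<in>cycle_edges n. edge_value g x e)
          = g (x (Suc m), x 0) * (\<Prod>i<Suc m. g (x i, x (Suc i)))"
        unfolding m using n m by (intro prod_cycle_edges sym) simp
      moreover have "(\<Prod>i<Suc m. A (x i, x (Suc i)))
          = (\<Prod>i<Suc m. r (x i) * r (x (Suc i))) * (\<Prod>i<Suc m. g (x i, x (Suc i)))"
        unfolding prod.distrib[symmetric] by (intro prod.cong) (auto simp: A_def)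
      ultimately show ?thesis by (simp add: A_def mult_ac del: prod.lessThan_Suc)
    qed
    then show ?thesis unfolding hom_density_def by (simp add: m lessThan_Suc_atMost del: prod.lessThan_Suc)
  qed
  also have "\<dots> = (\<integral>x. gram B (x (Suc m), x 0) * (\<Prod>i<Suc m. gram B (x i, x (Suc i))) \<partial>cube {..Suc m})"
  proof (rule integral_cong_AE[OF meas_cycle[OF A] meas_cycle[OF G]])
    show "AE x in cube {..Suc m}. A (x (Suc m), x 0) * (\<Prod>i<Suc m. A (x i, x (Suc i)))
        = gram B (x (Suc m), x 0) * (\<Prod>i<Suc m. gram B (x i, x (Suc i)))"
      using AE_path[of "Suc m"] AE_close by eventually_elim (simp only:)
  qed
  also have "\<dots> = (\<integral>p. gram B p * kpow (gram B) m p \<partial>(M \<Otimes>\<^sub>M M))"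
    using integral_walk[OF G G, of m] by (simp add: gram_swap[of B "_ (Suc m)"] del: prod.lessThan_Suc)
  also have "\<dots> = (\<integral>s. (\<integral>t. gram B (s, t) * kpow (gram B) m (s, t) \<partial>M) \<partial>M)"
    by (intro integral_square bounded_borel_mult G bounded_kpow)
  also have "\<dots> = (\<integral>s. kpow (gram B) (Suc m) (s, s) \<partial>M)"
    by (simp add: kcomp_def mult.commute gram_swap)
  finally have cycle: "hom_density M {..<n} (cycle_edges n) g (\<lambda>_. \<phi>) = \<dots>" .
  \<comment> \<open>the integral of the same power over the square is the density of a path\<close>
  have "(\<integral>p. A p \<partial>(M \<Otimes>\<^sub>M M)) ^ n \<le> hom_density M {..n} (path_edges n) A (\<lambda>_ _. 1)"
  proof -
    have "vertex_mean {..n} (path_edges n) (\<lambda>_ _. 1) = (\<lambda>_. 1)"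
      by (simp add: vertex_mean_def fun_eq_iff)
    moreover have "card (path_edges n) = n"
    proof -
      have "inj_on (\<lambda>i. {i, Suc i}) {..<n}" by (auto simp: inj_on_def doubleton_eq_iff)
      then show ?thesis by (simp add: path_edges_def card_image)
    qed
    ultimately show ?thesis
      using A.dominates_path[of "Suc m"] unfolding m dominates_def
      by (auto dest!: spec[of _ "\<lambda>_ _. 1"])
  qed
  also have "\<dots> = (\<integral>x. (\<Prod>i<n. A (x i, x (Suc i))) \<partial>cube {..n})"
    by (simp add: hom_density_def prod_path_edges[OF A.sym])
  also have "\<dots> = (\<integral>x. (\<Prod>i<n. gram B (x i, x (Suc i))) \<partial>cube {..n})"
    by (rule integral_cong_AE[OF meas_path[OF A] meas_path[OF G] AE_path])
  also have "\<dots> = (\<integral>p. kpow (gram B) (Suc m) p \<partial>(M \<Otimes>\<^sub>M M))"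
    using integral_walk[OF G bounded_borel_const[of _ 1], of "Suc m"] by (simp add: m del: prod.lessThan_Suc)
  also have "\<dots> \<le> (\<integral>s. kpow (gram B) (Suc m) (s, s) \<partial>M)"
  proof -
    obtain C where C: "bounded_borel (M \<Otimes>\<^sub>M M) C"
      and eq: "\<forall>p \<in> space (M \<Otimes>\<^sub>M M). kpow (gram B) (Suc m) p = gram C p"
      using kpow_gram_is_gram[OF B] by blast
    have "(\<integral>p. kpow (gram B) (Suc m) p \<partial>(M \<Otimes>\<^sub>M M)) = (\<integral>p. gram C p \<partial>(M \<Otimes>\<^sub>M M))"
      using eq by (intro Bochner_Integration.integral_cong) auto
    moreover have "(\<integral>s. kpow (gram B) (Suc m) (s, s) \<partial>M) = (\<integral>s. gram C (s, s) \<partial>M)"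
      using eq by (intro Bochner_Integration.integral_cong) (auto simp: space_pair_measure simp del: kpow.simps)
    ultimately show ?thesis using trace_gram_ge[OF C] by simp
  qed
  also note cycle[symmetric]
  finally show ?thesis by (simp add: A_def r_def)
qed

end

context real_prob_space
begin

lemma hom_density_reindex:
  assumes G: "simple_graph V' E'" and \<sigma>: "bij_betw \<sigma> V' V"
    and g: "symmetric_kernel g" "bounded_borel (M \<Otimes>\<^sub>M M) g"
    and f: "\<And>v. v \<in> V \<Longrightarrow> bounded_borel M (f v)"
  shows "hom_density M V ((`) \<sigma> ` E') g f = hom_density M V' E' g (f \<circ> \<sigma>)"
proof -
  have inj: "inj_on \<sigma> V'" and V: "V = \<sigma> ` V'" using \<sigma> by (auto simp: bij_betw_def)
  have EV: "E' \<subseteq> Pow V'" using G by (auto simp: simple_graph_def)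
  let ?t = "\<lambda>\<omega>. \<lambda>v\<in>V'. \<omega> (\<sigma> v)"
  let ?F = "\<lambda>x. (\<Prod>e\<in>E'. edge_value g x e) * (\<Prod>v\<in>V'. (f \<circ> \<sigma>) v (x v))"
  have t: "?t \<in> measurable (cube V) (cube V')"
    using V by (intro measurable_restrict measurable_component_singleton) auto
  have F: "bounded_borel (cube V') ?F"
    using f V by (intro bounded_borel_integrand g G) auto
  have F_t: "?F (?t x) = (\<Prod>e\<in>(`) \<sigma> ` E'. edge_value g x e) * (\<Prod>v\<in>V. f v (x v))" for x
  proof -
    have "edge_value g (?t x) e = edge_value g x (\<sigma> ` e)" if e: "e \<in> E'" for e
    proof -
      obtain u v where "e = {u, v}" "u \<in> V'" "v \<in> V'" using G e by (rule simple_graph_edgeE)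
      then show ?thesis by (simp add: edge_value_pair[OF g(1)])
    qed
    then have "(\<Prod>e\<in>E'. edge_value g (?t x) e) = (\<Prod>e\<in>(`) \<sigma> ` E'. edge_value g x e)"
      using inj_on_subset[OF inj_on_image_Pow[OF inj] EV] by (simp add: prod.reindex)
    moreover have "(\<Prod>v\<in>V'. (f \<circ> \<sigma>) v (?t x v)) = (\<Prod>v\<in>V. f v (x v))"
      unfolding V by (simp add: prod.reindex[OF inj])
    ultimately show ?thesis by simp
  qed
  have "distr (cube V) (cube V') ?t = cube V'"
    using V by (intro distr_PiM_reindex inj) (auto intro: prob_space_axioms)
  then have "hom_density M V' E' g (f \<circ> \<sigma>) = (\<integral>x. ?F x \<partial>distr (cube V) (cube V') ?t)"
    by (simp add: hom_density_def)
  also have "\<dots> = (\<integral>x. ?F (?t x) \<partial>cube V)"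
    by (rule integral_distr[OF t bounded_borel_measurable[OF F]])
  finally show ?thesis unfolding hom_density_def F_t by simp
qed

end

lemma bij_betw_shift:
  fixes n :: nat assumes "0 < n"
  shows "bij_betw (\<lambda>v. (v + j) mod n) {..<n} {..<n}"
proof -
  have "inj_on (\<lambda>v. (v + j) mod n) {..<n}"
  proof (rule inj_onI)
    fix u v assume uv: "u \<in> {..<n}" "v \<in> {..<n}" "(u + j) mod n = (v + j) mod n"
    then obtain p q where "u + j + n * p = v + j + n * q" by (auto simp: nat_mod_eq_iff)
    then have "u + n * p = v + n * q" by simp
    then have "u mod n = v mod n" by (auto simp: nat_mod_eq_iff)
    then show "u = v" using uv by simp
  qed
  moreover have "(\<lambda>v. (v + j) mod n) ` {..<n} \<subseteq> {..<n}" using assms by auto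
  ultimately show ?thesis
    by (simp add: bij_betw_def endo_inj_surj)
qed

lemma shift_cycle_edges:
  assumes "0 < n"
  shows "(`) (\<lambda>v. (v + j) mod n) ` cycle_edges n = cycle_edges n"
proof -
  let ?s = "\<lambda>v. (v + j) mod n"
  have "?s ` {i, Suc i mod n} = {?s i, Suc (?s i) mod n}" for i
  proof -
    have "?s (Suc i mod n) = Suc (?s i) mod n" by (simp add: mod_simps)
    then show ?thesis by simp
  qed
  then have "(`) ?s ` cycle_edges n = (\<lambda>i. {i, Suc i mod n}) ` ?s ` {..<n}"
    by (simp add: cycle_edges_def image_image)
  then show ?thesis using bij_betw_shift[OF assms] by (simp add: cycle_edges_def bij_betw_def)
qed

context psd_kernel
begin

text \<open>
  All rotations of the weights give the same density, so it equals the integral of the arithmetic mean of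
  the rotated integrands. Their geometric mean carries the weight \<open>\<phi>\<close>, the geometric mean of all weights,
  at every vertex, because each weight visits each vertex exactly once.
\<close>

lemma dominates_standard_cycle:
  assumes n: "3 \<le> n"
  shows "dominates M g {..<n} (cycle_edges n)"
  unfolding dominates_def
proof (intro allI impI)
  fix f :: "nat \<Rightarrow> real \<Rightarrow> real"
  assume f: "\<forall>v\<in>{..<n}. bounded_borel M (f v) \<and> (\<forall>t. 0 \<le> f v t)"
  let ?E = "cycle_edges n"
  let ?s = "\<lambda>j v. (v + j) mod n"
  have n0: "0 < n" using n by simp
  have s: "?s j v \<in> {..<n}" for j v using n0 by simp
  note G = simple_graph_cycle[OF n]
  define F where "F = (\<lambda>t. \<Prod>u<n. f u t)"
  define \<phi> where "\<phi> = (\<lambda>t. F t powr (1 / n))"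
  have F0: "0 \<le> F t" for t unfolding F_def using f by (intro prod_nonneg) auto
  have bF: "bounded_borel M F" unfolding F_def using f by (intro bounded_borel_prod) auto
  have b\<phi>: "bounded_borel M \<phi>" unfolding \<phi>_def using bF F0 by (intro bounded_borel_powr) auto
  let ?I = "\<lambda>f x. (\<Prod>e\<in>?E. edge_value g x e) * (\<Prod>v\<in>{..<n}. f v (x v))"
  have int: "integrable (cube {..<n}) (?I h)" if "\<And>v. v < n \<Longrightarrow> bounded_borel M (h v)" for h
    using that by (intro integrable_cube bounded_borel_integrand sym bounded G) auto
  have rot: "hom_density M {..<n} ?E g (f \<circ> ?s j) = hom_density M {..<n} ?E g f" for j
    using hom_density_reindex[OF G bij_betw_shift[OF n0, of j] sym bounded, of f] f
    by (simp add: shift_cycle_edges[OF n0])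
  have AMGM: "?I (\<lambda>_. \<phi>) x \<le> (\<Sum>j<n. ?I (f \<circ> ?s j) x / n)" for x
  proof -
    let ?g = "\<Prod>e\<in>?E. edge_value g x e"
    have g0: "0 \<le> ?g"
    proof (rule prod_nonneg)
      fix e assume "e \<in> ?E"
      then obtain u v where "e = {u, v}" using G by (auto elim: simple_graph_edgeE)
      then show "0 \<le> edge_value g x e" by (simp add: edge_value_pair[OF sym] nonneg)
    qed
    have "(\<Prod>j<n. f (?s j v) t) = F t" for v t
    proof -
      have "(\<Prod>j<n. f (?s j v) t) = (\<Prod>u\<in>(\<lambda>j. (j + v) mod n) ` {..<n}. f u t)"
        using bij_betw_shift[OF n0, of v] by (subst prod.reindex) (auto simp: bij_betw_def add.commute)
      then show ?thesis using bij_betw_shift[OF n0, of v] by (simp add: F_def bij_betw_def)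
    qed
    then have "(\<Prod>j<n. ?I (f \<circ> ?s j) x) = ?g ^ n * (\<Prod>v<n. F (x v))"
      by (simp add: prod.distrib prod.swap[of _ "{..<n}" "{..<n}"])
    moreover have "(?g ^ n) powr (1 / n) = ?g"
      using g0 n0 by (simp add: powr_powr flip: powr_realpow')
    ultimately have "(\<Prod>j<n. ?I (f \<circ> ?s j) x) powr (1 / n) = ?I (\<lambda>_. \<phi>) x"
      using F0 by (simp add: powr_mult \<phi>_def prod_powr_distrib)
    moreover have "0 \<le> ?I (f \<circ> ?s j) x" for j
      using f s by (intro mult_nonneg_nonneg[OF g0] prod_nonneg) auto
    then have "(\<Prod>j\<in>{..<n}. ?I (f \<circ> ?s j) x) powr (1 / card {..<n})
        \<le> (\<Sum>j\<in>{..<n}. ?I (f \<circ> ?s j) x / card {..<n})"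
      using n0 by (intro arith_geom_mean) auto
    ultimately show ?thesis by simp
  qed
  have "card ?E = n" using n by (rule card_cycle_edges)
  then have "vertex_mean {..<n} ?E f t = sqrt (\<phi> t)" for t
    by (simp add: vertex_mean_def \<phi>_def F_def powr_powr mult.commute flip: powr_half_sqrt)
  then have "(\<integral>(s, t). vertex_mean {..<n} ?E f s * g (s, t) * vertex_mean {..<n} ?E f t \<partial>(M \<Otimes>\<^sub>M M)) ^ card ?E
      \<le> hom_density M {..<n} ?E g (\<lambda>_. \<phi>)"
    using hom_density_cycle_const[OF n b\<phi>] card_cycle_edges[OF n] by (simp add: \<phi>_def)
  also have "\<dots> \<le> (\<integral>x. (\<Sum>j<n. ?I (f \<circ> ?s j) x / n) \<partial>cube {..<n})"
    unfolding hom_density_def using b\<phi> f s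
    by (intro integral_mono int AMGM Bochner_Integration.integrable_sum integrable_divide) auto
  also have "\<dots> = (\<Sum>j<n. hom_density M {..<n} ?E g (f \<circ> ?s j) / n)"
  proof (subst Bochner_Integration.integral_sum)
    show "integrable (cube {..<n}) (\<lambda>x. ?I (f \<circ> ?s j) x / n)" for j
      using f s by (intro integrable_divide int) auto
  qed (simp add: hom_density_def)
  also have "\<dots> = hom_density M {..<n} ?E g f" using n0 by (simp add: rot)
  finally show "(\<integral>(s, t). vertex_mean {..<n} ?E f s * g (s, t) * vertex_mean {..<n} ?E f t \<partial>(M \<Otimes>\<^sub>M M)) ^ card ?E
      \<le> hom_density M {..<n} ?E g f" .
qed

lemma dominates_cycle:
  assumes n: "3 \<le> n" and \<sigma>: "bij_betw \<sigma> {..<n} V"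
  shows "dominates M g V ((`) \<sigma> ` cycle_edges n)"
  unfolding dominates_def
proof (intro allI impI)
  fix f :: "'a \<Rightarrow> real \<Rightarrow> real"
  assume f: "\<forall>v\<in>V. bounded_borel M (f v) \<and> (\<forall>t. 0 \<le> f v t)"
  let ?E = "(`) \<sigma> ` cycle_edges n"
  have inj: "inj_on \<sigma> {..<n}" and V: "V = \<sigma> ` {..<n}" using \<sigma> by (auto simp: bij_betw_def)
  note G = simple_graph_cycle[OF n]
  have "cycle_edges n \<subseteq> Pow {..<n}" using G by (auto simp: simple_graph_def)
  then have card: "card ?E = card (cycle_edges n)"
    by (intro card_image inj_on_subset[OF inj_on_image_Pow[OF inj]])
  have "vertex_mean V ?E f = vertex_mean {..<n} (cycle_edges n) (f \<circ> \<sigma>)"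
    by (simp add: vertex_mean_def fun_eq_iff card V prod.reindex[OF inj])
  moreover have "hom_density M V ?E g f = hom_density M {..<n} (cycle_edges n) g (f \<circ> \<sigma>)"
    using f by (intro hom_density_reindex G \<sigma> sym bounded) auto
  moreover have "\<forall>v\<in>{..<n}. bounded_borel M ((f \<circ> \<sigma>) v) \<and> (\<forall>t. 0 \<le> (f \<circ> \<sigma>) v t)"
    using f V by auto
  ultimately show "(\<integral>(s, t). vertex_mean V ?E f s * g (s, t) * vertex_mean V ?E f t \<partial>(M \<Otimes>\<^sub>M M)) ^ card ?E
      \<le> hom_density M V ?E g f"
    using dominates_standard_cycle[OF n] unfolding dominates_def card by simp
qed

end

section \<open>Lebesgue measure on the unit square\<close>

lemma (in complete_measure) borel_measurable_AE_eq:
  fixes f g :: "'a \<Rightarrow> 'b :: topological_space"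
  assumes f: "f \<in> borel_measurable M" and eq: "AE x in M. f x = g x"
  shows "g \<in> borel_measurable M"
proof (rule measurableI)
  fix A :: "'b set" assume A: "A \<in> sets borel"
  have "AE x in M. x \<in> f -` A \<inter> space M \<longleftrightarrow> x \<in> g -` A \<inter> space M"
    using eq by eventually_elim auto
  then show "g -` A \<inter> space M \<in> sets M"
    by (rule in_sets_AE) (use f A in \<open>auto intro: measurable_sets\<close>)
qed simp

lemma (in complete_measure) integral_AE_eq:
  fixes f g :: "'a \<Rightarrow> real"
  assumes f: "f \<in> borel_measurable M" and eq: "AE x in M. f x = g x"
  shows "(\<integral>x. f x \<partial>M) = (\<integral>x. g x \<partial>M)"
  by (rule integral_cong_AE[OF f borel_measurable_AE_eq[OF f eq] eq])

lemma complete_measure_lebesgue_on: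
  assumes "S \<in> sets lebesgue" shows "complete_measure (lebesgue_on S)"
proof
  fix A B assume "B \<subseteq> A" "A \<in> null_sets (lebesgue_on S)"
  then show "B \<in> sets (lebesgue_on S)"
    using assms completion.complete2[of B A lborel]
    by (auto simp: null_sets_restrict_space sets_restrict_space_iff)
qed

lemma null_set_fst:
  assumes "N \<in> null_sets (lborel :: real measure)"
  shows "fst -` N \<in> null_sets (lborel :: (real \<times> real) measure)"
proof -
  have "fst -` N = N \<times> (UNIV :: real set)" by auto
  moreover have "N \<times> (UNIV :: real set) \<in> null_sets (lborel \<Otimes>\<^sub>M lborel)"
    using assms by (auto simp: null_sets_def lborel.emeasure_pair_measure_Times)
  ultimately show ?thesis by (simp add: lborel_prod)
qed

lemma null_set_snd:
  assumes "N \<in> null_sets (lborel :: real measure)"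
  shows "snd -` N \<in> null_sets (lborel :: (real \<times> real) measure)"
proof -
  have "snd -` N = (UNIV :: real set) \<times> N" by auto
  moreover have "(UNIV :: real set) \<times> N \<in> null_sets (lborel \<Otimes>\<^sub>M lborel)"
    using assms by (auto simp: null_sets_def lborel.emeasure_pair_measure_Times)
  ultimately show ?thesis by (simp add: lborel_prod)
qed

lemma AE_fst_snd:
  assumes "AE x in (lborel :: real measure). Q x"
  shows "AE p in (lborel :: (real \<times> real) measure). Q (fst p)"
    and "AE p in (lborel :: (real \<times> real) measure). Q (snd p)"
proof -
  obtain N where N: "N \<in> null_sets lborel" "{x \<in> space lborel. \<not> Q x} \<subseteq> N"
    using assms unfolding eventually_ae_filter by auto
  show "AE p in (lborel :: (real \<times> real) measure). Q (fst p)"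
    using N by (intro AE_I'[OF null_set_fst[OF N(1)]]) auto
  show "AE p in (lborel :: (real \<times> real) measure). Q (snd p)"
    using N by (intro AE_I'[OF null_set_snd[OF N(1)]]) auto
qed

text \<open>
  Cylinders over null sets are null, so the projections remain measurable between the completions.
\<close>

lemma measurable_fst_lebesgue: "fst \<in> measurable (lebesgue :: (real \<times> real) measure) (lebesgue :: real measure)"
proof (rule completion.measurable_completion2)
  show "fst \<in> measurable (lebesgue :: (real \<times> real) measure) (lborel :: real measure)"
    by (intro measurable_completion) (simp add: borel_prod[symmetric] cong: measurable_cong_sets)
  then show "null_sets lborel \<subseteq> null_sets (distr (lebesgue :: (real \<times> real) measure) (lborel :: real measure) fst)"
    using null_set_fst by (auto simp: null_sets_def emeasure_distr dest!: null_sets_completionI)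
qed

lemma measurable_snd_lebesgue: "snd \<in> measurable (lebesgue :: (real \<times> real) measure) (lebesgue :: real measure)"
proof (rule completion.measurable_completion2)
  show "snd \<in> measurable (lebesgue :: (real \<times> real) measure) (lborel :: real measure)"
    by (intro measurable_completion) (simp add: borel_prod[symmetric] cong: measurable_cong_sets)
  then show "null_sets lborel \<subseteq> null_sets (distr (lebesgue :: (real \<times> real) measure) (lborel :: real measure) snd)"
    using null_set_snd by (auto simp: null_sets_def emeasure_distr dest!: null_sets_completionI)
qed

text \<open>
  Each factor agrees with a Borel set up to a null set, and so does the rectangle.
\<close>

lemma emeasure_lebesgue_Times:
  fixes A B :: "real set"
  assumes A: "A \<in> sets lebesgue" and B: "B \<in> sets lebesgue"
  shows "A \<times> B \<in> sets lebesgue"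
    and "emeasure lebesgue (A \<times> B) = emeasure lebesgue A * emeasure lebesgue B"
proof -
  have "A \<times> B = (fst -` A \<inter> space lebesgue) \<inter> (snd -` B \<inter> space lebesgue)" by auto
  then show AB: "A \<times> B \<in> sets lebesgue"
    using measurable_sets[OF measurable_fst_lebesgue A] measurable_sets[OF measurable_snd_lebesgue B]
    by auto
  define A' where "A' = main_part lborel A"
  define B' where "B' = main_part lborel B"
  have b: "A' \<in> sets lborel" "B' \<in> sets lborel" unfolding A'_def B'_def by (intro main_part_sets A B)+
  have ae: "AE x in lborel. x \<in> C \<longleftrightarrow> x \<in> main_part lborel C" if C: "C \<in> sets lebesgue" for C :: "real set"
  proof -
    obtain N where N: "N \<in> null_sets lborel" "null_part lborel C \<subseteq> N" using null_part[OF C] by auto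
    show ?thesis
    proof (rule AE_I'[OF N(1)])
      show "{x \<in> space lborel. (x \<in> C) \<noteq> (x \<in> main_part lborel C)} \<subseteq> N"
        using N(2) main_part_null_part_Un[OF C] by blast
    qed
  qed
  have "AE p in (lborel :: (real \<times> real) measure). fst p \<in> A \<longleftrightarrow> fst p \<in> A'"
    "AE p in (lborel :: (real \<times> real) measure). snd p \<in> B \<longleftrightarrow> snd p \<in> B'"
    using AE_fst_snd(1)[OF ae[OF A]] AE_fst_snd(2)[OF ae[OF B]] by (auto simp: A'_def B'_def)
  then have "AE p in lborel. p \<in> A \<times> B \<longleftrightarrow> p \<in> A' \<times> B'"
    by eventually_elim (auto simp: mem_Times_iff)
  then have "AE p in lebesgue. p \<in> A \<times> B \<longleftrightarrow> p \<in> A' \<times> B'" by (rule AE_completion)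
  moreover have A'B': "A' \<times> B' \<in> sets (lborel \<Otimes>\<^sub>M lborel)" using b by simp
  then have A'B'_prod: "A' \<times> B' \<in> sets (lborel :: (real \<times> real) measure)"
    unfolding lborel_prod .
  ultimately have "emeasure lebesgue (A \<times> B) = emeasure lebesgue (A' \<times> B')"
    by (intro emeasure_eq_AE AB sets_completionI_sets)
  also have "\<dots> = emeasure (lborel \<Otimes>\<^sub>M lborel) (A' \<times> B')"
    unfolding lborel_prod using A'B'_prod by simp
  also have "\<dots> = emeasure lborel A' * emeasure lborel B'"
    using b by (intro lborel.emeasure_pair_measure_Times)
  finally show "emeasure lebesgue (A \<times> B) = emeasure lebesgue A * emeasure lebesgue B"
    using A B by (simp add: A'_def B'_def)
qed

notation unit_interval_measure ("\<mu>")
notation unit_square_measure ("\<mu>\<^sub>2")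

lemma unit_square_lebesgue: "{0..1} \<times> {0..1} \<in> sets (lebesgue :: (real \<times> real) measure)"
  by (intro emeasure_lebesgue_Times) auto

interpretation unit: real_prob_space \<mu>
  by (intro real_prob_space.intro prob_spaceI) (simp add: emeasure_restrict_space)

lemma sets_unit: "A \<in> sets \<mu> \<longleftrightarrow> A \<subseteq> {0..1} \<and> A \<in> sets lebesgue"
  by (simp add: sets_restrict_space_iff)

lemma measurable_id_square: "(\<lambda>p. p) \<in> measurable \<mu>\<^sub>2 (\<mu> \<Otimes>\<^sub>M \<mu>)"
proof -
  have "fst \<in> measurable \<mu>\<^sub>2 \<mu>"
    by (rule measurable_restrict_space3[OF measurable_fst_lebesgue]) auto
  moreover have "snd \<in> measurable \<mu>\<^sub>2 \<mu>"
    by (rule measurable_restrict_space3[OF measurable_snd_lebesgue]) auto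
  ultimately show ?thesis by (simp add: measurable_pair_iff comp_def)
qed

text \<open>
  The product sigma-algebra of two copies of the Lebesgue sets is contained in the Lebesgue sets of the
  square; on it, the two measures agree, as they do on rectangles.
\<close>

lemma distr_square: "distr \<mu>\<^sub>2 (\<mu> \<Otimes>\<^sub>M \<mu>) (\<lambda>p. p) = \<mu> \<Otimes>\<^sub>M \<mu>"
proof (rule pair_measure_eqI[symmetric])
  fix A B assume A: "A \<in> sets \<mu>" and B: "B \<in> sets \<mu>"
  then have *: "A \<in> sets lebesgue" "B \<in> sets lebesgue" "A \<subseteq> {0..1}" "B \<subseteq> {0..1}"
    by (auto simp: sets_unit)
  then have sub: "A \<times> B \<subseteq> {0..1} \<times> {0..1}" by auto
  have "emeasure (distr \<mu>\<^sub>2 (\<mu> \<Otimes>\<^sub>M \<mu>) (\<lambda>p. p)) (A \<times> B) = emeasure \<mu>\<^sub>2 (A \<times> B)"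
    using A B sub by (subst emeasure_distr[OF measurable_id_square]) (auto simp: Int_absorb2)
  also have "\<dots> = emeasure lebesgue (A \<times> B)"
    using sub unit_square_lebesgue by (intro emeasure_restrict_space) auto
  also have "\<dots> = emeasure \<mu> A * emeasure \<mu> B"
    using * by (simp add: emeasure_lebesgue_Times emeasure_restrict_space del: emeasure_completion)
  finally show "emeasure \<mu> A * emeasure \<mu> B = emeasure (distr \<mu>\<^sub>2 (\<mu> \<Otimes>\<^sub>M \<mu>) (\<lambda>p. p)) (A \<times> B)" ..
qed (auto intro: unit.sigma_finite_measure_axioms)

lemma measurable_id_borel: "(\<lambda>p. p) \<in> measurable (\<mu> \<Otimes>\<^sub>M \<mu>) (borel :: (real \<times> real) measure)"
proof -
  have "(\<lambda>x. x) \<in> measurable \<mu> borel"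
    by (intro measurable_restrict_space1 measurable_completion) simp
  then have "(\<lambda>p. (fst p, snd p)) \<in> measurable (\<mu> \<Otimes>\<^sub>M \<mu>) (borel \<Otimes>\<^sub>M borel)" by measurable
  then show ?thesis by (simp add: borel_prod)
qed

text \<open>
  A Lebesgue null set of the square need not be measurable for the product sigma-algebra, but it is
  covered by a Borel null set, which is.
\<close>

lemma AE_square_pair:
  assumes "AE p in \<mu>\<^sub>2. Q p" shows "AE p in \<mu> \<Otimes>\<^sub>M \<mu>. Q p"
proof -
  have "AE p in lebesgue. p \<in> {0..1} \<times> {0..1} \<longrightarrow> Q p"
    using assms unit_square_lebesgue by (subst (asm) AE_restrict_space_iff) auto
  then have "AE p in lborel. p \<in> {0..1} \<times> {0..1} \<longrightarrow> Q p" by (simp add: AE_completion_iff)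
  then obtain N where N: "N \<in> null_sets lborel" "{p \<in> space lborel. \<not> (p \<in> {0..1} \<times> {0..1} \<longrightarrow> Q p)} \<subseteq> N"
    unfolding eventually_ae_filter by auto
  let ?N = "N \<inter> ({0..1} \<times> {0..1})"
  from measurable_sets[OF measurable_id_borel, of N] have sets: "?N \<in> sets (\<mu> \<Otimes>\<^sub>M \<mu>)"
    using N(1) by (simp add: null_sets_def space_pair_measure)
  have "emeasure (\<mu> \<Otimes>\<^sub>M \<mu>) ?N = emeasure \<mu>\<^sub>2 ?N"
    using sets by (subst distr_square[symmetric], subst emeasure_distr[OF measurable_id_square])
      (auto intro!: arg_cong[where f = "emeasure \<mu>\<^sub>2"])
  also have "\<dots> = emeasure lebesgue ?N"
    using unit_square_lebesgue by (intro emeasure_restrict_space) auto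
  also have "\<dots> = 0"
  proof -
    have "N \<in> null_sets lebesgue" using N(1) by (rule null_sets_completionI)
    then have "?N \<in> null_sets lebesgue" using unit_square_lebesgue by (rule null_set_Int2)
    then show ?thesis by auto
  qed
  finally have "?N \<in> null_sets (\<mu> \<Otimes>\<^sub>M \<mu>)" using sets by auto
  then show ?thesis
    by (rule AE_I') (use N(2) in \<open>auto simp: space_pair_measure\<close>)
qed

lemma integral_square_pair:
  fixes F :: "real \<times> real \<Rightarrow> real"
  assumes "F \<in> borel_measurable (\<mu> \<Otimes>\<^sub>M \<mu>)"
  shows "(\<integral>p. F p \<partial>\<mu>\<^sub>2) = (\<integral>p. F p \<partial>(\<mu> \<Otimes>\<^sub>M \<mu>))"
  using integral_distr[OF measurable_id_square assms] by (simp add: distr_square)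

text \<open>
  Lebesgue measurable functions agree with Borel functions almost everywhere. Truncation restores
  the bound on the exceptional set.
\<close>

lemma bounded_borel_version:
  assumes "bounded_measurable \<mu>\<^sub>2 f"
  obtains f' where "bounded_borel (\<mu> \<Otimes>\<^sub>M \<mu>) f'" "AE p in \<mu> \<Otimes>\<^sub>M \<mu>. f p = f' p"
proof -
  let ?S = "{0..1} \<times> {0..1} :: (real \<times> real) set"
  have f: "f \<in> borel_measurable \<mu>\<^sub>2" and "bounded (f ` ?S)"
    using assms by (auto simp: bounded_measurable_def)
  then obtain C where C: "\<And>p. p \<in> ?S \<Longrightarrow> \<bar>f p\<bar> \<le> C" by (auto simp: bounded_iff)
  have "(\<lambda>p. if p \<in> ?S then f p else 0) \<in> borel_measurable lebesgue"
    using f unit_square_lebesgue by (subst borel_measurable_if) auto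
  then obtain f1 where f1: "f1 \<in> borel_measurable lborel"
    and ae: "AE p in lborel. (if p \<in> ?S then f p else 0) = f1 p"
    using completion_ex_borel_measurable_real by blast
  define f' where "f' = (\<lambda>p. max (- \<bar>C\<bar>) (min \<bar>C\<bar> (f1 p)))"
  have "AE p in lebesgue. p \<in> ?S \<longrightarrow> f p = f' p"
    using AE_completion[OF ae]
  proof eventually_elim
    case (elim p)
    show ?case
    proof
      assume "p \<in> ?S"
      with elim C[of p] show "f p = f' p" by (auto simp: f'_def)
    qed
  qed
  then have "AE p in \<mu>\<^sub>2. f p = f' p"
    using unit_square_lebesgue by (subst AE_restrict_space_iff) auto
  then have "AE p in \<mu> \<Otimes>\<^sub>M \<mu>. f p = f' p" by (rule AE_square_pair)
  moreover have "bounded_borel (\<mu> \<Otimes>\<^sub>M \<mu>) f'"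
  proof (rule bounded_borelI)
    have "f1 \<in> borel_measurable borel" using f1 by simp
    then have "f1 \<in> borel_measurable (\<mu> \<Otimes>\<^sub>M \<mu>)"
      by (rule measurable_compose[OF measurable_id_borel])
    then show "f' \<in> borel_measurable (\<mu> \<Otimes>\<^sub>M \<mu>)" unfolding f'_def by measurable
    show "\<bar>f' p\<bar> \<le> \<bar>C\<bar>" for p by (auto simp: f'_def)
  qed
  ultimately show ?thesis using that by blast
qed

text \<open>
  The Borel version of \<open>g\<close> is symmetrised, and its absolute value is taken, in order to be symmetric and
  nonnegative without exceptions. The roots \<open>h\<close> and \<open>h'\<close> agree on almost every row up to a null set, so
  their Gram kernels agree almost everywhere. Rows of \<open>h\<close> that agree with those of \<open>h'\<close> up to a null set are
  measurable by completeness.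
\<close>

lemma psd_version:
  assumes g: "doubly_nonnegative g"
  obtains g' h' where "psd_kernel \<mu> g' h'" "AE p in \<mu> \<Otimes>\<^sub>M \<mu>. g p = g' p"
proof -
  obtain h where h: "bounded_measurable \<mu>\<^sub>2 h"
    and gh: "AE (x, y) in \<mu>\<^sub>2. g (x, y) = (\<integral>z. h (x, z) * h (y, z) \<partial>\<mu>)"
    and bg: "bounded_measurable \<mu>\<^sub>2 g"
    and g0: "\<And>x y. x \<in> {0..1} \<Longrightarrow> y \<in> {0..1} \<Longrightarrow> 0 \<le> g (x, y) \<and> g (x, y) = g (y, x)"
    using g by (auto simp: doubly_nonnegative_def)
  obtain g1 where g1: "bounded_borel (\<mu> \<Otimes>\<^sub>M \<mu>) g1" and ae1: "AE p in \<mu> \<Otimes>\<^sub>M \<mu>. g p = g1 p"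
    using bounded_borel_version[OF bg] .
  obtain h' where h': "bounded_borel (\<mu> \<Otimes>\<^sub>M \<mu>) h'" and aeh: "AE p in \<mu> \<Otimes>\<^sub>M \<mu>. h p = h' p"
    using bounded_borel_version[OF h] .
  define g' where "g' = (\<lambda>p. \<bar>g1 p + g1 (snd p, fst p)\<bar> / 2)"
  have ae: "AE p in \<mu> \<Otimes>\<^sub>M \<mu>. g p = g' p"
    using ae1 unit.AE_pair_swap[OF ae1] AE_space
  proof eventually_elim
    case (elim p)
    then show ?case using g0[of "fst p" "snd p"]
      by (cases p) (auto simp: g'_def space_pair_measure)
  qed
  have bg': "bounded_borel (\<mu> \<Otimes>\<^sub>M \<mu>) g'"
  proof -
    have "bounded_borel (\<mu> \<Otimes>\<^sub>M \<mu>) (\<lambda>p. g1 p + g1 (snd p, fst p))"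
      by (intro bounded_borel_add g1 bounded_borel_compose[OF g1]) measurable
    note b = this
    obtain C where C: "\<And>p. \<bar>g1 p + g1 (snd p, fst p)\<bar> \<le> C"
      using bounded_borel_bound[OF b] by blast
    note m = bounded_borel_measurable[OF b]
    show ?thesis
    proof (rule bounded_borelI)
      show "g' \<in> borel_measurable (\<mu> \<Otimes>\<^sub>M \<mu>)" unfolding g'_def using m by measurable
      show "\<bar>g' p\<bar> \<le> C" for p using C[of p] by (simp add: g'_def)
    qed
  qed
  have "AE x in \<mu>. AE z in \<mu>. h (x, z) = h' (x, z)"
    using unit.square.AE_pair[OF aeh] .
  note rows = unit.AE_pair_fst[OF this]
  interpret complete: complete_measure \<mu> by (rule complete_measure_lebesgue_on) simp
  have "AE p in \<mu> \<Otimes>\<^sub>M \<mu>. g' p = unit.gram h' p"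
    using ae AE_square_pair[OF gh] rows unit.AE_pair_swap[OF rows] AE_space
  proof eventually_elim
    case (elim p)
    obtain s t where p: "p = (s, t)" by (cases p)
    have st: "s \<in> space \<mu>" "t \<in> space \<mu>" using elim(5) p by (auto simp: space_pair_measure)
    have "AE z in \<mu>. h (s, z) = h' (s, z)" "AE z in \<mu>. h (t, z) = h' (t, z)"
      using elim(3,4) p by auto
    then have "AE z in \<mu>. h' (s, z) * h' (t, z) = h (s, z) * h (t, z)"
      by eventually_elim simp
    moreover have "bounded_borel \<mu> (\<lambda>z. h' (s, z) * h' (t, z))"
      using st by (intro bounded_borel_mult unit.bounded_row h')
    then have "(\<lambda>z. h' (s, z) * h' (t, z)) \<in> borel_measurable \<mu>" by (rule bounded_borel_measurable)
    ultimately have "unit.gram h' p = (\<integral>z. h (s, z) * h (t, z) \<partial>\<mu>)"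
      unfolding p unit.gram_eq by (intro complete.integral_AE_eq)
    then show ?case using elim(1,2) p by simp
  qed
  then have "psd_kernel \<mu> g' h'"
    using bg' h' by unfold_locales (auto simp: symmetric_kernel_def g'_def add.commute)
  then show ?thesis using ae that by blast
qed

text \<open>
  Replacing \<open>g\<close> by its Borel version changes neither side of the inequality. On the left this uses that
  two different coordinates of the cube avoid a given null set of the square almost surely.
\<close>

lemma extra_goodI:
  fixes V :: "'a set"
  assumes G: "simple_graph V E" "E \<noteq> {}"
    and dom: "\<And>g h. psd_kernel \<mu> g h \<Longrightarrow> dominates \<mu> g V E"
  shows "extra_good V E"
  unfolding extra_good_def
proof (intro conjI G allI impI)
  fix g :: "real \<times> real \<Rightarrow> real" and f :: "'a \<Rightarrow> real \<Rightarrow> real"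
  assume g: "doubly_nonnegative g"
    and f: "\<forall>v\<in>V. bounded_measurable \<mu> (f v) \<and> (\<forall>t\<in>{0..1}. 0 \<le> f v t)"
  note fin = simple_graph_finite[OF G(1)]
  obtain g' h' where psd: "psd_kernel \<mu> g' h'" and ae: "AE p in \<mu> \<Otimes>\<^sub>M \<mu>. g p = g' p"
    using psd_version[OF g] .
  interpret psd_kernel \<mu> g' h' by (rule psd)
  have gsym: "g (x, y) = g (y, x)" if "x \<in> {0..1}" "y \<in> {0..1}" for x y
    using g that by (simp add: doubly_nonnegative_def)
  \<comment> \<open>outside the unit interval the weights may be unbounded or negative\<close>
  define f' where "f' = (\<lambda>v t. if t \<in> {0..1} then f v t else 0)"
  have f': "bounded_borel \<mu> (f' v) \<and> (\<forall>t. 0 \<le> f' v t)" if v: "v \<in> V" for v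
  proof
    have m: "f v \<in> borel_measurable \<mu>" and "bounded (f v ` {0..1})"
      using f v by (auto simp: bounded_measurable_def)
    then obtain C where "\<forall>y\<in>f v ` {0..1}. norm y \<le> C" by (auto simp only: bounded_iff)
    then have C: "\<bar>f v t\<bar> \<le> C" if "t \<in> {0..1}" for t using that by simp
    show "bounded_borel \<mu> (f' v)"
    proof (rule bounded_borelI)
      have "f v \<in> borel_measurable \<mu> \<longleftrightarrow> f' v \<in> borel_measurable \<mu>"
        by (intro measurable_cong) (simp add: f'_def)
      then show "f' v \<in> borel_measurable \<mu>" using m by simp
      show "\<bar>f' v t\<bar> \<le> \<bar>C\<bar>" for t using C[of t] by (auto simp: f'_def)
    qed
    show "\<forall>t. 0 \<le> f' v t" using f v by (simp add: f'_def)
  qed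
  let ?I = "\<lambda>g f x. (\<Prod>e\<in>E. edge_value g x e) * (\<Prod>v\<in>V. f v (x v))"
  have AE_edges: "AE x in unit.cube V. \<forall>e\<in>E. edge_value g' x e = edge_value g x e"
  proof (rule AE_finite_allI[OF fin(2)])
    fix e assume "e \<in> E"
    with G(1) obtain u v where e: "e = {u, v}" "u \<noteq> v" "u \<in> V" "v \<in> V" by (rule simple_graph_edgeE)
    have "AE x in unit.cube V. g (x u, x v) = g' (x u, x v)"
      by (rule unit.AE_cube_pair[where Q = "\<lambda>p. g p = g' p", OF e(3,4,2) fin(1) ae])
    then show "AE x in unit.cube V. edge_value g' x e = edge_value g x e"
      using AE_space
    proof eventually_elim
      case (elim x)
      then have "x u \<in> {0..1}" "x v \<in> {0..1}" using e(3,4) by (auto simp: space_PiM PiE_iff)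
      then have "edge_value g x e = g (x u, x v)"
        unfolding e(1) by (intro edge_value_eq gsym)
      then show ?case using elim(1) by (simp add: e(1) edge_value_pair[OF sym])
    qed
  qed
  have "AE x in unit.cube V. ?I g' f' x = ?I g f x"
    using AE_edges AE_space
  proof eventually_elim
    case (elim x)
    have "f' v (x v) = f v (x v)" if "v \<in> V" for v
      using elim(2) that by (auto simp: f'_def space_PiM dest!: PiE_mem)
    then show ?case using elim(1) by simp
  qed
  then have "AE x in unit_cube_measure V. ?I g' f' x = ?I g f x" by (rule AE_completion)
  moreover have m: "?I g' f' \<in> borel_measurable (unit.cube V)"
    by (intro bounded_borel_measurable unit.bounded_borel_integrand sym bounded G) (use f' in auto)
  ultimately have "(\<integral>x. ?I g' f' x \<partial>unit_cube_measure V) = (\<integral>x. ?I g f x \<partial>unit_cube_measure V)"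
    by (intro completion.integral_AE_eq measurable_completion)
  then have lhs: "hom_density \<mu> V E g' f' = (\<integral>x. ?I g f x \<partial>unit_cube_measure V)"
    by (simp add: hom_density_def integral_completion[OF m])
  let ?m = "vertex_mean V E f" and ?m' = "vertex_mean V E f'"
  have bm': "bounded_borel \<mu> ?m'" using fin f' by (intro bounded_vertex_mean)
  have mm': "?m' t = ?m t" if "t \<in> {0..1}" for t
    using that by (simp add: vertex_mean_def f'_def)
  interpret sq: complete_measure \<mu>\<^sub>2 by (rule complete_measure_lebesgue_on[OF unit_square_lebesgue])
  have bK: "bounded_borel (\<mu> \<Otimes>\<^sub>M \<mu>) (\<lambda>(s, t). ?m' s * g' (s, t) * ?m' t)"
    by (intro bounded_weighted bm')
  note mK = bounded_borel_measurable[OF bK]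
  have "AE p in \<mu>\<^sub>2. g p = g' p"
  proof -
    have "AE p in distr \<mu>\<^sub>2 (\<mu> \<Otimes>\<^sub>M \<mu>) (\<lambda>p. p). g p = g' p"
      unfolding distr_square by (rule ae)
    then show ?thesis by (rule AE_distrD[OF measurable_id_square])
  qed
  then have "AE p in \<mu>\<^sub>2. (\<lambda>(s, t). ?m' s * g' (s, t) * ?m' t) p = (\<lambda>(s, t). ?m s * g (s, t) * ?m t) p"
    using AE_space by eventually_elim (auto simp: mm' unit_square_lebesgue)
  then have "(\<integral>p. (\<lambda>(s, t). ?m' s * g' (s, t) * ?m' t) p \<partial>\<mu>\<^sub>2)
      = (\<integral>p. (\<lambda>(s, t). ?m s * g (s, t) * ?m t) p \<partial>\<mu>\<^sub>2)"
    by (intro sq.integral_AE_eq measurable_compose[OF measurable_id_square mK])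
  then have rhs: "(\<integral>(s, t). ?m' s * g' (s, t) * ?m' t \<partial>(\<mu> \<Otimes>\<^sub>M \<mu>))
      = (\<integral>(s, t). ?m s * g (s, t) * ?m t \<partial>\<mu>\<^sub>2)"
    using integral_square_pair[OF mK] by simp
  show "(\<integral>(s, t). ?m s * g (s, t) * ?m t \<partial>\<mu>\<^sub>2) ^ card E \<le> (\<integral>x. ?I g f x \<partial>unit_cube_measure V)"
    using dom[OF psd] f' unfolding dominates_def lhs[symmetric] rhs[symmetric] by blast
qed

theorem corollary6p4:
  fixes V :: "'a set" and E :: "'a set set"
  shows "(tree V E \<and> E \<noteq> {} \<longrightarrow> extra_good V E) \<and> (unicyclic V E \<longrightarrow> extra_good V E)"
proof (intro conjI impI)
  assume tree: "tree V E \<and> E \<noteq> {}"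
  show "extra_good V E"
  proof (rule extra_goodI)
    show "simple_graph V E" "E \<noteq> {}" using tree by (auto simp: tree_def connected_graph_def)
    fix g h assume "psd_kernel \<mu> g h"
    then interpret psd_kernel \<mu> g h .
    show "dominates \<mu> g V E"
      using conjunct1[OF tree] conjunct2[OF tree]
      by (induction rule: tree_induct) (auto intro: dominates_edge dominates_add_leaf)
  qed
next
  assume uni: "unicyclic V E"
  show "extra_good V E"
  proof (rule extra_goodI)
    show G: "simple_graph V E" using uni by (simp add: unicyclic_def connected_graph_def)
    have "V \<noteq> {}" "card E = card V" using uni by (auto simp: unicyclic_def connected_graph_def)
    then show "E \<noteq> {}" using simple_graph_finite[OF G] by auto
    fix g h assume "psd_kernel \<mu> g h"
    then interpret psd_kernel \<mu> g h .
    show "dominates \<mu> g V E"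
      using uni
      by (induction rule: unicyclic_induct) (auto intro: dominates_cycle dominates_add_leaf)
  qed
qed

end
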